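(* Let $T>0$, $\beta\in(0,1)$, and let $h\in C_b(\mathbb R\times[0,T])$ be locally $\beta$-Hölder continuous in $\mathbb R\times(0,T)$. Let $u:\mathbb R\times[0,T]\to\mathbb R$ be bounded and Lipschitz continuous with $u_x\in L^\infty$, such that for all $(x,t)\in\mathbb R\times[0,T]$ $$u(x,t)=\inf_{\gamma\in H^1((t,T)),\ \gamma(t)=x}\int_t^T\Big(\tfrac12|\dot\gamma(s)|^2+h(\gamma(s),s)\Big)ds+u(\gamma(T),T),$$ and such that $w(x,t):=-u(x,T-t)$ satisfies $$w(x,t)=\inf_{\gamma\in H^1((t,T)),\ \gamma(t)=x}\int_t^T\Big(\tfrac12|\dot\gamma(s)|^2+h(\gamma(s),T-s)\Big)ds+w(\gamma(T),T).$$ Then $u\in C^{1,\beta/2}_{loc}(\mathbb R\times(0,T))$.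
   Context: In the paper this is applied with $h=f(m)$, where $(u,m)$ is a solution of the one-dimensional MFG system $-u_t+\frac12u_x^2=f(m)$, $m_t-(mu_x)_x=0$ (for the planning problem, $u$ being the particular solution obtained by the approximation construction), for which both representation formulas hold. $C^{1,\beta/2}_{loc}$ means $u$ is $C^1$ in space-time with locally $\beta/2$-Hölder continuous first derivatives. *)

theory Defs
  imports "HOL-Analysis.Analysis"
begin

text \<open>gamma is an H^1 path on [a,b] with (weak) derivative g:
  g is square integrable on [a,b] and gamma(s) = gamma(a) + int_a^s g.\<close>
definition H1_path :: "real \<Rightarrow> real \<Rightarrow> (real \<Rightarrow> real) \<Rightarrow> (real \<Rightarrow> real) \<Rightarrow> bool" where
  "H1_path a b \<gamma> g \<longleftrightarrow>
     set_integrable lborel {a..b} g \<and>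
     set_integrable lborel {a..b} (\<lambda>s. (g s)\<^sup>2) \<and>
     (\<forall>s\<in>{a..b}. \<gamma> s = \<gamma> a + set_lebesgue_integral lborel {a..s} g)"

definition action :: "(real \<Rightarrow> real \<Rightarrow> real) \<Rightarrow> real \<Rightarrow> real \<Rightarrow> (real \<Rightarrow> real) \<Rightarrow> (real \<Rightarrow> real) \<Rightarrow> real" where
  "action h t T \<gamma> g = set_lebesgue_integral lborel {t..T} (\<lambda>s. (1/2) * (g s)\<^sup>2 + h (\<gamma> s) s)"

definition value_repr :: "(real \<Rightarrow> real \<Rightarrow> real) \<Rightarrow> real \<Rightarrow> (real \<Rightarrow> real \<Rightarrow> real) \<Rightarrow> bool" where
  "value_repr h T v \<longleftrightarrow>
     (\<forall>x. \<forall>t\<in>{0..T}. v x t =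
        Inf {action h t T \<gamma> g + v (\<gamma> T) T | \<gamma> g. H1_path t T \<gamma> g \<and> \<gamma> t = x})"

definition locally_holder_on :: "real \<Rightarrow> (real \<times> real) set \<Rightarrow> (real \<times> real \<Rightarrow> real) \<Rightarrow> bool" where
  "locally_holder_on \<alpha> \<Omega> f \<longleftrightarrow>
     (\<forall>K. compact K \<and> K \<subseteq> \<Omega> \<longrightarrow>
        (\<exists>C. \<forall>p\<in>K. \<forall>q\<in>K. \<bar>f p - f q\<bar> \<le> C * dist p q powr \<alpha>))"

definition C1_holder_loc :: "real \<Rightarrow> (real \<times> real) set \<Rightarrow> (real \<times> real \<Rightarrow> real) \<Rightarrow> bool" where
  "C1_holder_loc \<alpha> \<Omega> f \<longleftrightarrow>
     (\<exists>fx ft. (\<forall>p\<in>\<Omega>. (f has_derivative (\<lambda>(a, b). fx p * a + ft p * b)) (at p)) \<and>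
        locally_holder_on \<alpha> \<Omega> fx \<and> locally_holder_on \<alpha> \<Omega> ft)"

end

theory Submission
  imports Defs
begin

text \<open>At scale r, take an almost minimal path from (x, t) on the short time interval of length
  \<tau> = r powr (1 - \<beta>/2), which balances r^2/\<tau> against \<tau> * r powr \<beta>. Such a path moves with bounded
  mean speed and stays within O(r) of its chord. Competing with the straight lines that join
  (x + k, t + l) to the endpoint of the path bounds u(x + k, t + l) - u(x, t) from above by a linear
  form in (k, l) up to O(r powr (1 + \<beta>/2)), for all \<bar>k\<bar>, \<bar>l\<bar> \<le> r. The same bound for the
  time-reversed value function is a bound from below. The two linear forms then almost agree, so u is
  affine up to O(r powr (1 + \<beta>/2)) at every scale r, locally uniformly, and by comparing dyadic scales
  (Campanato) it is C^{1, \<beta>/2}.\<close>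

section \<open>Finite-energy paths\<close>

text \<open>As h is only Hoelder continuous, no Euler-Lagrange equation gives near-minimal paths a
  regular velocity. The rigidity used instead is energetic: the chord is itself a competitor, so a
  path deviating by \<delta> from it saves at most order \<tau> * \<delta> powr \<beta> of running
  cost, up to the near-minimality slack, and its excess kinetic energy is bounded by that.
  Cauchy-Schwarz turns this into \<delta>^2 of order \<tau>^2 * \<delta> powr \<beta> + r^2, and
  since \<tau>^2 = r powr (2 - \<beta>) it closes exactly at \<delta> of order r. The speed bound
  alone would only give a deviation of order \<tau>, hence an error of order r to the exponent (1 -
  \<beta>/2)(1 + \<beta>) = 1 + \<beta>/2 - \<beta>^2/2, which falls short of the target. A slack of
  r powr (1 + \<beta>/2) in minimality is of the same order as the other errors, so near-minimizers
  replace minimizers throughout.\<close>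

lemma integral_square_diff_const:
  fixes g :: "real \<Rightarrow> real"
  assumes "a \<le> b" "g integrable_on {a..b}" "(\<lambda>s. (g s)\<^sup>2) integrable_on {a..b}"
  shows "((\<lambda>s. (g s - m)\<^sup>2) has_integral
    integral {a..b} (\<lambda>s. (g s)\<^sup>2) - 2 * m * integral {a..b} g + (b - a) * m\<^sup>2) {a..b}"
proof -
  have "((\<lambda>s. (g s)\<^sup>2 - 2 * m * g s + m\<^sup>2) has_integral
      integral {a..b} (\<lambda>s. (g s)\<^sup>2) - 2 * m * integral {a..b} g + (b - a) * m\<^sup>2) {a..b}"
    using assms
    by (intro has_integral_add has_integral_diff has_integral_mult_right integrable_integral)
       (use has_integral_const_real[of "m\<^sup>2" a b] in auto)
  then show ?thesis by (simp add: power2_diff algebra_simps)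
qed

text \<open>Cauchy-Schwarz, read off from the nonnegative variance: expand the square about the mean
  m. The same expansion, with m the chord velocity, later measures the excess kinetic
  energy.\<close>

lemma integral_square_le:
  fixes g :: "real \<Rightarrow> real"
  assumes "a \<le> b" "g integrable_on {a..b}" "(\<lambda>s. (g s)\<^sup>2) integrable_on {a..b}"
  shows "(integral {a..b} g)\<^sup>2 \<le> (b - a) * integral {a..b} (\<lambda>s. (g s)\<^sup>2)"
proof (cases "a = b")
  case True
  then show ?thesis by simp
next
  case False
  define m where "m = integral {a..b} g / (b - a)"
  have eq: "integral {a..b} g = (b - a) * m" using False assms by (simp add: m_def)
  have "0 \<le> integral {a..b} (\<lambda>s. (g s)\<^sup>2) - 2 * m * integral {a..b} g + (b - a) * m\<^sup>2"
    by (rule has_integral_nonneg[OF integral_square_diff_const[OF assms]]) simp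
  then have "(b - a) * m\<^sup>2 \<le> integral {a..b} (\<lambda>s. (g s)\<^sup>2)"
    unfolding eq by (simp add: power2_eq_square algebra_simps)
  then have "(b - a) * ((b - a) * m\<^sup>2) \<le> (b - a) * integral {a..b} (\<lambda>s. (g s)\<^sup>2)"
    using assms by (intro mult_left_mono) auto
  then show ?thesis
    unfolding eq by (simp add: power_mult_distrib power2_eq_square mult_ac)
qed

text \<open>Passes from Lebesgue to gauge integrals, in which all later estimates are carried
  out.\<close>

lemma H1_pathD:
  assumes "H1_path a b \<gamma> g"
  shows "g integrable_on {a..b}" "(\<lambda>s. (g s)\<^sup>2) integrable_on {a..b}"
    "\<And>s. s \<in> {a..b} \<Longrightarrow> \<gamma> s = \<gamma> a + integral {a..s} g"
    "continuous_on {a..b} \<gamma>"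
proof -
  from assms have g: "set_integrable lborel {a..b} g"
    and g2: "set_integrable lborel {a..b} (\<lambda>s. (g s)\<^sup>2)"
    and eq: "\<And>s. s \<in> {a..b} \<Longrightarrow> \<gamma> s = \<gamma> a + set_lebesgue_integral lborel {a..s} g"
    unfolding H1_path_def by blast+
  show gi: "g integrable_on {a..b}" "(\<lambda>s. (g s)\<^sup>2) integrable_on {a..b}"
    using set_borel_integral_eq_integral(1) g g2 by auto
  show *: "\<gamma> s = \<gamma> a + integral {a..s} g" if "s \<in> {a..b}" for s
  proof -
    have "set_integrable lborel {a..s} g"
      by (rule set_integrable_subset[OF g]) (use that in auto)
    then show ?thesis using eq[OF that] set_borel_integral_eq_integral(2) by metis
  qed
  have "continuous_on {a..b} (\<lambda>s. \<gamma> a + integral {a..s} g)"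
    by (intro continuous_intros indefinite_integral_continuous_1 gi)
  then show "continuous_on {a..b} \<gamma>"
    by (rule continuous_on_eq) (rule *[symmetric])
qed

lemma H1_path_subinterval:
  assumes p: "H1_path a b \<gamma> g" and "a \<le> c" "d \<le> b"
  shows "H1_path c d \<gamma> g"
proof -
  have sub: "{c..d} \<subseteq> {a..b}" using assms by auto
  have g: "set_integrable lborel {c..d} g" "set_integrable lborel {c..d} (\<lambda>s. (g s)\<^sup>2)"
    using p sub unfolding H1_path_def by (auto intro: set_integrable_subset)
  have "\<gamma> s = \<gamma> c + set_lebesgue_integral lborel {c..s} g" if s: "s \<in> {c..d}" for s
  proof -
    have "\<gamma> s = \<gamma> a + integral {a..s} g" "\<gamma> c = \<gamma> a + integral {a..c} g"
      by (rule H1_pathD(3)[OF p]; use s assms in auto)+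
    moreover have "integral {a..c} g + integral {c..s} g = integral {a..s} g"
      by (rule Henstock_Kurzweil_Integration.integral_combine)
         (use s assms in \<open>auto intro!: integrable_subinterval_real[OF H1_pathD(1)[OF p]]\<close>)
    moreover have "set_lebesgue_integral lborel {c..s} g = integral {c..s} g"
      by (rule set_borel_integral_eq_integral(2), rule set_integrable_subset[OF g(1)]) (use s in auto)
    ultimately show ?thesis by simp
  qed
  then show ?thesis using g unfolding H1_path_def by blast
qed

text \<open>Compares running costs of two paths that end together but start at different times. Here
  m stands for the value of h at the base point: the unmatched initial piece contributes (a - a') *
  m, the term linear in the time shift, and every pointwise error is e. Both signs of the shift are
  covered.\<close>

lemma integral_shifted_le:
  fixes f F :: "real \<Rightarrow> real"
  assumes f: "f integrable_on {a'..b}" and F: "F integrable_on {a..b}"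
    and "a \<le> b" "a' \<le> b"
    and fF: "\<And>s. \<lbrakk>a \<le> s; a' \<le> s; s \<le> b\<rbrakk> \<Longrightarrow> f s \<le> F s + e"
    and fm: "\<And>s. \<lbrakk>a' \<le> s; s \<le> a\<rbrakk> \<Longrightarrow> f s \<le> m + e"
    and Fm: "\<And>s. \<lbrakk>a \<le> s; s \<le> a'\<rbrakk> \<Longrightarrow> m - e \<le> F s"
  shows "integral {a'..b} f - integral {a..b} F \<le> (a - a') * m + e * (b - min a a')"
proof -
  define c where "c = max a a'"
  have sub: "f integrable_on {c..b}" "F integrable_on {c..b}"
    using f F by (auto intro: integrable_subinterval_real simp: c_def)
  have "integral {c..b} f \<le> integral {c..b} (\<lambda>s. F s + e)"
    by (rule integral_le)
       (use sub fF in \<open>auto intro!: Henstock_Kurzweil_Integration.integrable_add simp: c_def\<close>)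
  also have "\<dots> = integral {c..b} F + e * (b - c)"
    using sub assms(3,4) by (subst Henstock_Kurzweil_Integration.integral_add) (auto simp: c_def)
  finally have 1: "integral {c..b} f \<le> integral {c..b} F + e * (b - c)" .
  show ?thesis
  proof (cases "a \<le> a'")
    case True
    then have c: "c = a'" by (simp add: c_def)
    have "integral {a..a'} (\<lambda>_. m - e) \<le> integral {a..a'} F"
      by (rule integral_le) (use F Fm assms(4) in \<open>auto intro: integrable_subinterval_real\<close>)
    moreover have "integral {a..a'} F + integral {a'..b} F = integral {a..b} F"
      by (rule Henstock_Kurzweil_Integration.integral_combine) (use True F assms in auto)
    ultimately show ?thesis using 1 True unfolding c by (simp add: algebra_simps)
  next
    case False
    then have c: "c = a" by (simp add: c_def)
    have "integral {a'..a} f \<le> integral {a'..a} (\<lambda>_. m + e)"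
      by (rule integral_le) (use f fm assms(3) in \<open>auto intro: integrable_subinterval_real\<close>)
    moreover have "integral {a'..a} f + integral {a..b} f = integral {a'..b} f"
      by (rule Henstock_Kurzweil_Integration.integral_combine) (use False f assms in auto)
    ultimately show ?thesis using 1 False unfolding c by (simp add: algebra_simps)
  qed
qed

text \<open>The inequality is scale invariant: with \<delta> = D * r the factor r^2 cancels and D^2
  \<le> 2 * H * D powr \<beta> + 2 remains. For D \<ge> 1 the right side is at most (2 * H + 2) * D,
  which bounds D.\<close>

lemma bootstrap_bound:
  fixes \<delta> r H \<beta> :: real
  assumes "0 < r" "0 \<le> H" "\<beta> \<le> 1"
    and le: "\<delta>\<^sup>2 \<le> 2 * H * r powr (2 - \<beta>) * \<delta> powr \<beta> + 2 * r\<^sup>2"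
  shows "\<delta> \<le> (2 * H + 2) * r"
proof (rule ccontr)
  assume "\<not> ?thesis"
  then have less: "(2 * H + 2) * r < \<delta>" by simp
  define D where "D = \<delta> / r"
  have \<delta>: "\<delta> = D * r" using assms by (simp add: D_def)
  have D: "2 * H + 2 < D" using less assms unfolding \<delta> by simp
  then have D1: "1 \<le> D" using assms by simp
  have "D powr \<beta> \<le> D powr 1" by (rule powr_mono) (use assms D1 in auto)
  then have "D powr \<beta> \<le> D" using D1 by simp
  have "(D * r) powr \<beta> = D powr \<beta> * r powr \<beta>"
    using assms D1 by (simp add: powr_mult)
  moreover have "r powr (2 - \<beta>) * r powr \<beta> = r\<^sup>2"
    using assms by (simp flip: powr_add)
  ultimately have "(D * r)\<^sup>2 \<le> 2 * H * D powr \<beta> * r\<^sup>2 + 2 * r\<^sup>2"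
    using le unfolding \<delta> by (simp add: mult_ac)
  then have "D\<^sup>2 * r\<^sup>2 \<le> (2 * H * D powr \<beta> + 2) * r\<^sup>2" by (simp add: power_mult_distrib algebra_simps)
  then have "D\<^sup>2 \<le> 2 * H * D powr \<beta> + 2" using assms by simp
  also have "\<dots> \<le> 2 * H * D + 2 * D"
    using \<open>D powr \<beta> \<le> D\<close> assms D1 by (intro add_mono mult_left_mono) auto
  finally have "D * D \<le> (2 * H + 2) * D" by (simp add: power2_eq_square algebra_simps)
  then have "D \<le> 2 * H + 2" using D1 by (simp add: mult_le_cancel_right)
  then show False using D by simp
qed

section \<open>Approximation by affine functions at all scales\<close>

lemma geometric_limit:
  fixes p :: "nat \<Rightarrow> real"
  assumes q: "0 < q" "q < 1" and step: "\<And>n. \<bar>p (Suc n) - p n\<bar> \<le> A * q ^ n"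
  obtains P where "\<And>n. \<bar>p n - P\<bar> \<le> A * q ^ n / (1 - q)"
proof -
  have A: "0 \<le> A" using step[of 0] by simp
  \<comment> \<open>The exact geometric sum with its factor \<open>1 - q ^ m\<close> is kept because
    the induction does not close on the cruder bound without it.\<close>
  have diff: "\<bar>p (n + m) - p n\<bar> \<le> A * q ^ n * (1 - q ^ m) / (1 - q)" for n m
  proof (induction m)
    case (Suc m)
    have "\<bar>p (n + Suc m) - p n\<bar> \<le> A * q ^ n * (1 - q ^ m) / (1 - q) + A * q ^ (n + m)"
      using Suc step[of "n + m"] by simp
    also have "\<dots> = A * q ^ n * (1 - q ^ Suc m) / (1 - q)"
      using q by (simp add: field_simps power_add)
    finally show ?case .
  qed simp
  have diff': "\<bar>p (n + m) - p n\<bar> \<le> A * q ^ n / (1 - q)" for n m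
  proof (rule order_trans[OF diff divide_right_mono])
    have "A * q ^ n * (1 - q ^ m) \<le> A * q ^ n * 1" using A q by (intro mult_left_mono) auto
    then show "A * q ^ n * (1 - q ^ m) \<le> A * q ^ n" by simp
  qed (use q in auto)
  have "summable (\<lambda>n. p (Suc n) - p n)"
    by (rule summable_comparison_test[OF _ summable_mult[OF summable_geometric]])
       (use step q in auto)
  then obtain P0 where "(\<lambda>n. \<Sum>i<n. p (Suc i) - p i) \<longlonglongrightarrow> P0"
    unfolding summable_def sums_def by blast
  then have "(\<lambda>n. p n - p 0) \<longlonglongrightarrow> P0" by (simp add: sum_lessThan_telescope)
  then have lim: "p \<longlonglongrightarrow> P0 + p 0"
    using tendsto_add[OF _ tendsto_const[of "p 0"], of "\<lambda>n. p n - p 0" P0 sequentially] by simp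
  show ?thesis
  proof (rule that[of "P0 + p 0"])
    fix n
    have "(\<lambda>m. \<bar>p n - p (m + n)\<bar>) \<longlonglongrightarrow> \<bar>p n - (P0 + p 0)\<bar>"
      by (intro tendsto_intros LIMSEQ_ignore_initial_segment lim)
    then show "\<bar>p n - (P0 + p 0)\<bar> \<le> A * q ^ n / (1 - q)"
      by (rule LIMSEQ_le_const2) (use diff'[of n] in \<open>auto simp: add.commute abs_minus_commute\<close>)
  qed
qed

lemma dyadic_scale:
  fixes r r0 :: real
  assumes "0 < r" "r \<le> r0"
  obtains n where "r \<le> r0 / 2 ^ n" "r0 / 2 ^ n \<le> 2 * r"
proof -
  define n where "n = nat \<lfloor>log 2 (r0 / r)\<rfloor>"
  have "1 \<le> r0 / r" using assms by simp
  then have "0 \<le> log 2 (r0 / r)" by simp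
  then have "real n \<le> log 2 (r0 / r)" "log 2 (r0 / r) < real n + 1"
    by (simp_all add: n_def)
  then have "2 ^ n \<le> r0 / r" "r0 / r \<le> 2 ^ Suc n"
    using assms by (simp_all add: le_log_iff log_less_iff powr_realpow powr_add)
  then show ?thesis using assms by (intro that[of n]) (simp_all add: field_simps)
qed

text \<open>The value at the centre is matched exactly, so only the two slopes can vary with the
  scale. The sup-norm box lets each slope be read off at (r, 0) or (0, r).\<close>

definition affine_within :: "(real \<Rightarrow> real \<Rightarrow> real) \<Rightarrow> real \<Rightarrow> real \<Rightarrow> real \<Rightarrow> real \<Rightarrow> real \<Rightarrow> real \<Rightarrow> bool" where
  "affine_within f x t r e p q \<longleftrightarrow>
     (\<forall>k l. \<bar>k\<bar> \<le> r \<longrightarrow> \<bar>l\<bar> \<le> r \<longrightarrow> \<bar>f (x + k) (t + l) - f x t - p * k - q * l\<bar> \<le> e)"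

lemma affine_withinD:
  "\<lbrakk>affine_within f x t r e p q; \<bar>k\<bar> \<le> r; \<bar>l\<bar> \<le> r\<rbrakk>
    \<Longrightarrow> \<bar>f (x + k) (t + l) - f x t - p * k - q * l\<bar> \<le> e"
  unfolding affine_within_def by blast

lemma affine_within_slope_diff:
  assumes "affine_within f x t r e p q" "affine_within f x t r' e' p' q'" "0 < r" "r \<le> r'"
  shows "\<bar>p' - p\<bar> * r \<le> e + e'" "\<bar>q' - q\<bar> * r \<le> e + e'"
proof -
  have "\<bar>(p' - p) * r\<bar> \<le> e + e'"
    using affine_withinD[OF assms(1), of r 0] affine_withinD[OF assms(2), of r 0] assms(3,4)
    unfolding left_diff_distrib by simp
  then show "\<bar>p' - p\<bar> * r \<le> e + e'" using assms(3) by (simp add: abs_mult)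
  have "\<bar>(q' - q) * r\<bar> \<le> e + e'"
    using affine_withinD[OF assms(1), of 0 r] affine_withinD[OF assms(2), of 0 r] assms(3,4)
    unfolding left_diff_distrib by simp
  then show "\<bar>q' - q\<bar> * r \<le> e + e'" using assms(3) by (simp add: abs_mult)
qed

text \<open>Comparing the two bounds at the reflected point (-k, -l) gives p' * k + q' * l \<ge> p *
  k + q * l - e - e', so the upper form, lowered by e + 2 * e', is also a lower bound. The bounds at
  (0, 0) supply the signs of e and e'.\<close>

lemma affine_within_two_sided:
  assumes up: "\<And>k l. \<lbrakk>\<bar>k\<bar> \<le> r; \<bar>l\<bar> \<le> r\<rbrakk> \<Longrightarrow> f (x + k) (t + l) - f x t \<le> p * k + q * l + e"
    and lo: "\<And>k l. \<lbrakk>\<bar>k\<bar> \<le> r; \<bar>l\<bar> \<le> r\<rbrakk> \<Longrightarrow> p' * k + q' * l - e' \<le> f (x + k) (t + l) - f x t"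
  shows "affine_within f x t r (e + 2 * e') p q"
  unfolding affine_within_def
proof (intro allI impI)
  fix k l :: real assume kl: "\<bar>k\<bar> \<le> r" "\<bar>l\<bar> \<le> r"
  have "0 \<le> r" using kl by linarith
  have "p' * (- k) + q' * (- l) - e' \<le> p * (- k) + q * (- l) + e"
    using up[of "- k" "- l"] lo[of "- k" "- l"] kl by simp
  then show "\<bar>f (x + k) (t + l) - f x t - p * k - q * l\<bar> \<le> e + 2 * e'"
    using up[OF kl] lo[OF kl] up[of 0 0] lo[of 0 0] \<open>0 \<le> r\<close> by (simp add: abs_le_iff)
qed

text \<open>Campanato's argument: slopes at consecutive dyadic scales differ by at most 4 * C * R
  powr \<alpha>, which decays geometrically with ratio 2 powr - \<alpha>, so they converge and one
  pair of limit slopes serves every scale. In the constant, 8 is twice 4, one share for each slope,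
  and 2 powr (1 + \<alpha>) pays for rounding r up to a dyadic scale of size at most 2 * r.\<close>

lemma affine_within_all_scales:
  fixes f :: "real \<Rightarrow> real \<Rightarrow> real"
  assumes \<alpha>: "0 < \<alpha>" and r0: "0 < r0" and C: "0 \<le> C"
    and approx: "\<And>r. \<lbrakk>0 < r; r \<le> r0\<rbrakk> \<Longrightarrow> \<exists>p q. affine_within f x t r (C * r powr (1 + \<alpha>)) p q"
  obtains P Q where "\<And>r. \<lbrakk>0 < r; r \<le> r0\<rbrakk> \<Longrightarrow>
    affine_within f x t r (C * (1 + 8 / (1 - 2 powr - \<alpha>)) * 2 powr (1 + \<alpha>) * r powr (1 + \<alpha>)) P Q"
proof -
  define R where "R n = r0 / 2 ^ n" for n :: nat
  define \<theta> where "\<theta> = 2 powr - \<alpha>"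
  have \<theta>: "0 < \<theta>" "\<theta> < 1" using \<alpha> powr_less_mono[of "- \<alpha>" 0 2] by (simp_all add: \<theta>_def)
  have R: "0 < R n" "R n \<le> r0" for n using r0 by (auto simp: R_def divide_le_eq)
  have RS: "R n = 2 * R (Suc n)" for n by (simp add: R_def)
  have R\<alpha>: "R n powr \<alpha> = r0 powr \<alpha> * \<theta> ^ n" for n
  proof -
    have "(2 ^ n) powr \<alpha> = (2 powr \<alpha>) ^ n"
      by (simp add: powr_powr mult.commute flip: powr_realpow)
    then show ?thesis
      using r0 powr_divide[of r0 "2 ^ n" \<alpha>]
      by (simp add: R_def \<theta>_def powr_minus power_inverse divide_inverse)
  qed
  obtain p q where pq: "\<And>n. affine_within f x t (R n) (C * R n powr (1 + \<alpha>)) (p n) (q n)"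
    using approx[OF R] by metis
  have "\<bar>p n - p (Suc n)\<bar> * R (Suc n) \<le> 4 * C * R n powr \<alpha> * R (Suc n)
      \<and> \<bar>q n - q (Suc n)\<bar> * R (Suc n) \<le> 4 * C * R n powr \<alpha> * R (Suc n)" for n
  proof -
    have "R (Suc n) powr (1 + \<alpha>) \<le> R n powr (1 + \<alpha>)"
      using R[of "Suc n"] RS[of n] \<alpha> by (intro powr_mono2) auto
    then have "C * R (Suc n) powr (1 + \<alpha>) + C * R n powr (1 + \<alpha>) \<le> 2 * (C * R n powr (1 + \<alpha>))"
      using C mult_left_mono by fastforce
    also have "\<dots> = 4 * C * R n powr \<alpha> * R (Suc n)"
      using R[of n] RS[of n] by (simp add: powr_add)
    finally have le: "C * R (Suc n) powr (1 + \<alpha>) + C * R n powr (1 + \<alpha>)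
        \<le> 4 * C * R n powr \<alpha> * R (Suc n)" .
    have RR: "0 < R (Suc n)" "R (Suc n) \<le> R n" using R(1)[of "Suc n"] RS[of n] by simp_all
    show ?thesis
      by (intro conjI order_trans[OF affine_within_slope_diff(1)[OF pq pq RR] le]
          order_trans[OF affine_within_slope_diff(2)[OF pq pq RR] le])
  qed
  then have "\<bar>p n - p (Suc n)\<bar> \<le> 4 * C * R n powr \<alpha> \<and> \<bar>q n - q (Suc n)\<bar> \<le> 4 * C * R n powr \<alpha>" for n
    using R(1)[of "Suc n"] by (meson mult_le_cancel_right_pos)
  then have step: "\<bar>p (Suc n) - p n\<bar> \<le> 4 * C * r0 powr \<alpha> * \<theta> ^ n"
      "\<bar>q (Suc n) - q n\<bar> \<le> 4 * C * r0 powr \<alpha> * \<theta> ^ n" for n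
    by (simp_all add: R\<alpha> mult.assoc abs_minus_commute)
  obtain P where P: "\<And>n. \<bar>p n - P\<bar> \<le> 4 * C * r0 powr \<alpha> * \<theta> ^ n / (1 - \<theta>)"
    using geometric_limit[OF \<theta> step(1)] by blast
  obtain Q where Q: "\<And>n. \<bar>q n - Q\<bar> \<le> 4 * C * r0 powr \<alpha> * \<theta> ^ n / (1 - \<theta>)"
    using geometric_limit[OF \<theta> step(2)] by blast
  show ?thesis
  proof (rule that[of P Q])
    fix r assume r: "0 < r" "r \<le> r0"
    obtain n where n: "r \<le> R n" "R n \<le> 2 * r"
      unfolding R_def by (rule dyadic_scale[OF r])
    define D where "D = 4 * C * R n powr \<alpha> / (1 - \<theta>)"
    have D: "\<bar>p n - P\<bar> \<le> D" "\<bar>q n - Q\<bar> \<le> D"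
      using P[of n] Q[of n] by (simp_all add: D_def R\<alpha> mult.assoc)
    have D0: "0 \<le> D" using D(1) by linarith
    show "affine_within f x t r (C * (1 + 8 / (1 - 2 powr - \<alpha>)) * 2 powr (1 + \<alpha>) * r powr (1 + \<alpha>)) P Q"
      unfolding affine_within_def
    proof (intro allI impI)
      fix k l assume "\<bar>k\<bar> \<le> r" "\<bar>l\<bar> \<le> r"
      then have kl: "\<bar>k\<bar> \<le> R n" "\<bar>l\<bar> \<le> R n" using n by auto
      have "\<bar>(p n - P) * k\<bar> \<le> D * R n" "\<bar>(q n - Q) * l\<bar> \<le> D * R n"
        unfolding abs_mult using D kl D0 by (auto intro!: mult_mono)
      then have "\<bar>f (x + k) (t + l) - f x t - P * k - Q * l\<bar> \<le> C * R n powr (1 + \<alpha>) + 2 * (D * R n)"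
        using affine_withinD[OF pq[of n] kl] unfolding left_diff_distrib by linarith
      also have "2 * (D * R n) = C * R n powr (1 + \<alpha>) * (8 / (1 - \<theta>))"
        using R(1)[of n] by (simp add: D_def powr_add)
      also have "C * R n powr (1 + \<alpha>) + C * R n powr (1 + \<alpha>) * (8 / (1 - \<theta>))
          = C * (1 + 8 / (1 - \<theta>)) * R n powr (1 + \<alpha>)" by (simp add: algebra_simps)
      also have "\<dots> \<le> C * (1 + 8 / (1 - \<theta>)) * (2 * r) powr (1 + \<alpha>)"
        using n R(1)[of n] \<alpha> C \<theta> by (intro mult_left_mono powr_mono2) auto
      also have "\<dots> = C * (1 + 8 / (1 - \<theta>)) * 2 powr (1 + \<alpha>) * r powr (1 + \<alpha>)"
        using r by (simp add: powr_mult)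
      finally show "\<bar>f (x + k) (t + l) - f x t - P * k - Q * l\<bar>
          \<le> C * (1 + 8 / (1 - 2 powr - \<alpha>)) * 2 powr (1 + \<alpha>) * r powr (1 + \<alpha>)"
        by (simp add: \<theta>_def)
    qed
  qed
qed

lemma affine_within_has_derivative:
  assumes \<alpha>: "0 < \<alpha>" and r0: "0 < r0"
    and approx: "\<And>r. \<lbrakk>0 < r; r \<le> r0\<rbrakk> \<Longrightarrow> affine_within f x t r (C * r powr (1 + \<alpha>)) P Q"
  shows "((\<lambda>(x, t). f x t) has_derivative (\<lambda>(a, b). P * a + Q * b)) (at (x, t))"
proof -
  let ?g = "\<lambda>(x, t). f x t" and ?D = "\<lambda>(a, b). P * a + Q * b"
  have bl: "bounded_linear ?D"
    unfolding case_prod_beta by (intro bounded_linear_intros)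
  have "((\<lambda>z. norm (?g ((x, t) + z) - ?g (x, t) - ?D z) / norm z) \<longlongrightarrow> 0) (at 0)"
  proof (rule tendsto_sandwich[of "\<lambda>_. 0" _ _ "\<lambda>z. C * norm z powr \<alpha>"])
    have "\<forall>\<^sub>F z :: real \<times> real in at 0. z \<in> ball 0 r0 - {0}"
      using r0 by (intro eventually_at_in_open) auto
    then show "\<forall>\<^sub>F z in at 0. norm (?g ((x, t) + z) - ?g (x, t) - ?D z) / norm z \<le> C * norm z powr \<alpha>"
    proof eventually_elim
      case (elim z)
      then have z: "0 < norm z" "norm z \<le> r0" by auto
      have "\<bar>fst z\<bar> \<le> norm z" "\<bar>snd z\<bar> \<le> norm z"
        using norm_fst_le[of "fst z" "snd z"] norm_snd_le[of "snd z" "fst z"] by simp_all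
      then have "norm (?g ((x, t) + z) - ?g (x, t) - ?D z) \<le> C * norm z powr (1 + \<alpha>)"
        using affine_withinD[OF approx[OF z], of "fst z" "snd z"]
        by (simp add: case_prod_beta algebra_simps)
      also have "\<dots> = C * norm z powr \<alpha> * norm z" using z by (simp add: powr_add)
      finally show ?case using z by (simp add: divide_le_eq)
    qed
    have "((\<lambda>z :: real \<times> real. norm z powr \<alpha>) \<longlongrightarrow> 0) (at 0)"
      by (rule tendsto_zero_powrI[OF _ tendsto_const _ \<alpha>]) (auto intro: tendsto_norm_zero tendsto_ident_at)
    then show "((\<lambda>z :: real \<times> real. C * norm z powr \<alpha>) \<longlongrightarrow> 0) (at 0)"
      by (rule tendsto_mult_right_zero)
  qed auto
  then show ?thesis using bl unfolding has_derivative_at by simp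
qed

text \<open>Both affine functions predict the same increment of f from (x', t') by \<rho> in one
  coordinate. The one centred at (x, t) is tested at two points of its box of size 2 * \<rho>, each
  costing at most 4 * e because \<alpha> \<le> 1; the one centred at (x', t') costs e. Hence 9 = 4 +
  4 + 1.\<close>

lemma affine_within_slope_holder:
  assumes \<alpha>: "0 < \<alpha>" "\<alpha> \<le> 1" and C: "0 \<le> C"
    and approx: "\<And>r. \<lbrakk>0 < r; r \<le> r0\<rbrakk> \<Longrightarrow> affine_within f x t r (C * r powr (1 + \<alpha>)) P Q"
    and approx': "\<And>r. \<lbrakk>0 < r; r \<le> r0\<rbrakk> \<Longrightarrow> affine_within f x' t' r (C * r powr (1 + \<alpha>)) P' Q'"
    and \<rho>: "0 < \<rho>" "2 * \<rho> \<le> r0" "\<bar>x' - x\<bar> \<le> \<rho>" "\<bar>t' - t\<bar> \<le> \<rho>"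
  shows "\<bar>P' - P\<bar> \<le> 9 * C * \<rho> powr \<alpha>" "\<bar>Q' - Q\<bar> \<le> 9 * C * \<rho> powr \<alpha>"
proof -
  define k l where "k = x' - x" and "l = t' - t"
  have x't': "x' = x + k" "t' = t + l" by (simp_all add: k_def l_def)
  have kl: "\<bar>k\<bar> \<le> \<rho>" "\<bar>l\<bar> \<le> \<rho>" using \<rho> by (simp_all add: k_def l_def)
  have kl2: "\<bar>k + \<rho>\<bar> \<le> 2 * \<rho>" "\<bar>l + \<rho>\<bar> \<le> 2 * \<rho>" using kl by linarith+
  define e where "e = C * \<rho> powr (1 + \<alpha>)"
  have "C * (2 * \<rho>) powr (1 + \<alpha>) = 2 powr (1 + \<alpha>) * e" using \<rho> by (simp add: e_def powr_mult)
  also have "\<dots> \<le> 2 powr 2 * e" using \<alpha> C by (intro mult_right_mono powr_mono) (auto simp: e_def)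
  finally have E: "C * (2 * \<rho>) powr (1 + \<alpha>) \<le> 4 * e" by simp
  have A: "\<bar>f (x + a) (t + b) - f x t - P * a - Q * b\<bar> \<le> 4 * e" if "\<bar>a\<bar> \<le> 2 * \<rho>" "\<bar>b\<bar> \<le> 2 * \<rho>" for a b
    using affine_withinD[OF approx[of "2 * \<rho>"] that] \<rho> E by simp
  have A': "\<bar>f (x + (k + a)) (t + (l + b)) - f x' t' - P' * a - Q' * b\<bar> \<le> e"
    if "\<bar>a\<bar> \<le> \<rho>" "\<bar>b\<bar> \<le> \<rho>" for a b
    using affine_withinD[OF approx'[of \<rho>] that] \<rho> by (simp add: e_def x't' add.assoc)
  have *: "9 * e = 9 * C * \<rho> powr \<alpha> * \<rho>" using \<rho> by (simp add: e_def powr_add)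
  have "\<bar>(P' - P) * \<rho>\<bar> \<le> 9 * e"
    using A[of k l] A[of "k + \<rho>" l] A'[of \<rho> 0] kl2 kl \<rho>(1)
    by (simp add: x't' algebra_simps)
  then have "\<bar>P' - P\<bar> * \<rho> \<le> 9 * C * \<rho> powr \<alpha> * \<rho>"
    unfolding * abs_mult using \<rho> by simp
  then show "\<bar>P' - P\<bar> \<le> 9 * C * \<rho> powr \<alpha>" using \<rho> by simp
  have "\<bar>(Q' - Q) * \<rho>\<bar> \<le> 9 * e"
    using A[of k l] A[of k "l + \<rho>"] A'[of 0 \<rho>] kl2 kl \<rho>(1)
    by (simp add: x't' algebra_simps)
  then have "\<bar>Q' - Q\<bar> * \<rho> \<le> 9 * C * \<rho> powr \<alpha> * \<rho>"
    unfolding * abs_mult using \<rho> by simp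
  then show "\<bar>Q' - Q\<bar> \<le> 9 * C * \<rho> powr \<alpha>" using \<rho> by simp
qed

text \<open>Since K may be disconnected, distant points are not joined by a chain inside K; the
  uniform bound handles them, as their distance is at least d.\<close>

lemma holder_from_local_holder:
  fixes g :: "'a :: metric_space \<Rightarrow> real"
  assumes "0 < d" "0 < \<alpha>" "0 \<le> A"
    and local: "\<And>p q. \<lbrakk>p \<in> K; q \<in> K; p \<noteq> q; dist p q \<le> d\<rbrakk> \<Longrightarrow> \<bar>g p - g q\<bar> \<le> A * dist p q powr \<alpha>"
    and bound: "\<And>p. p \<in> K \<Longrightarrow> \<bar>g p\<bar> \<le> D"
  shows "\<exists>C. \<forall>p\<in>K. \<forall>q\<in>K. \<bar>g p - g q\<bar> \<le> C * dist p q powr \<alpha>"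
proof (intro exI ballI)
  fix p q assume pq: "p \<in> K" "q \<in> K"
  have D: "0 \<le> D" using bound[OF pq(1)] by linarith
  show "\<bar>g p - g q\<bar> \<le> (A + 2 * D / d powr \<alpha>) * dist p q powr \<alpha>"
  proof (cases "dist p q \<le> d")
    case True
    have "\<bar>g p - g q\<bar> \<le> A * dist p q powr \<alpha>"
      using local[OF pq _ True] by (cases "p = q") auto
    also have "\<dots> \<le> (A + 2 * D / d powr \<alpha>) * dist p q powr \<alpha>"
      using D by (intro mult_right_mono) auto
    finally show ?thesis .
  next
    case False
    then have "d powr \<alpha> \<le> dist p q powr \<alpha>" using assms by (intro powr_mono2) auto
    then have "2 * D \<le> 2 * D / d powr \<alpha> * dist p q powr \<alpha>"
      using D \<open>0 < d\<close> by (simp add: field_simps mult_left_mono)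
    moreover have "\<bar>g p - g q\<bar> \<le> 2 * D" using bound[OF pq(1)] bound[OF pq(2)] by linarith
    moreover have "0 \<le> A * dist p q powr \<alpha>" using assms by simp
    ultimately show ?thesis by (simp add: distrib_right)
  qed
qed

lemma compact_subset_box:
  fixes K :: "(real \<times> real) set"
  assumes "compact K" "K \<subseteq> UNIV \<times> {0<..<T}" "K \<noteq> {}"
  obtains R a b where "0 < a" "a \<le> b" "b < T" "\<And>x t. (x, t) \<in> K \<Longrightarrow> \<bar>x\<bar> \<le> R \<and> t \<in> {a..b}"
proof -
  have s: "compact (snd ` K)" "snd ` K \<noteq> {}"
    using assms by (auto intro!: compact_continuous_image continuous_intros)
  obtain a where a: "a \<in> snd ` K" "\<And>t. t \<in> snd ` K \<Longrightarrow> a \<le> t"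
    using compact_attains_inf[OF s] by blast
  obtain b where b: "b \<in> snd ` K" "\<And>t. t \<in> snd ` K \<Longrightarrow> t \<le> b"
    using compact_attains_sup[OF s] by blast
  have "bounded (fst ` K)"
    by (rule compact_imp_bounded, rule compact_continuous_image) (use assms in \<open>auto intro!: continuous_intros\<close>)
  then obtain R where R: "\<And>x. x \<in> fst ` K \<Longrightarrow> \<bar>x\<bar> \<le> R"
    unfolding bounded_iff by auto
  have "snd ` K \<subseteq> {0<..<T}" using assms(2) by auto
  then show ?thesis using a b R by (intro that[of a b R]) force+
qed

section \<open>Value functions\<close>

text \<open>The hypotheses are packaged so that they can be instantiated twice with the same
  constants, for the value function and for its time reversal.\<close>

locale value_function =
  fixes T \<beta> M B L :: real and h v :: "real \<Rightarrow> real \<Rightarrow> real"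
  assumes beta: "0 < \<beta>" "\<beta> < 1"
    and h_cont: "continuous_on (UNIV \<times> {0..T}) (\<lambda>(x, t). h x t)"
    and h_bdd: "\<And>x t. t \<in> {0..T} \<Longrightarrow> \<bar>h x t\<bar> \<le> M"
    and h_holder: "locally_holder_on \<beta> (UNIV \<times> {0<..<T}) (\<lambda>(x, t). h x t)"
    and v_bdd: "\<And>x t. t \<in> {0..T} \<Longrightarrow> \<bar>v x t\<bar> \<le> B"
    and v_lip: "L-lipschitz_on (UNIV \<times> {0..T}) (\<lambda>(x, t). v x t)"
    and v_repr: "value_repr h T v"
begin

section \<open>Actions of paths and dynamic programming\<close>

lemma h_along_continuous:
  assumes "continuous_on {a..b} \<gamma>" "0 \<le> a" "b \<le> T"
  shows "continuous_on {a..b} (\<lambda>s. h (\<gamma> s) s)"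
proof -
  have "continuous_on {a..b} ((\<lambda>(x, t). h x t) \<circ> (\<lambda>s. (\<gamma> s, s)))"
    by (rule continuous_on_compose)
       (use assms in \<open>auto intro!: continuous_intros continuous_on_subset[OF h_cont]\<close>)
  then show ?thesis by (simp add: o_def)
qed

lemma h_along_integrable:
  assumes "continuous_on {a..b} \<gamma>" "0 \<le> a" "b \<le> T"
  shows "(\<lambda>s. h (\<gamma> s) s) integrable_on {a..b}"
  by (rule integrable_continuous_real[OF h_along_continuous[OF assms]])

lemma action_eq:
  assumes p: "H1_path t T \<gamma> g" and t: "0 \<le> t"
  shows "action h t T \<gamma> g
    = 1/2 * integral {t..T} (\<lambda>s. (g s)\<^sup>2) + integral {t..T} (\<lambda>s. h (\<gamma> s) s)"
proof -
  have c: "continuous_on {t..T} (\<lambda>s. h (\<gamma> s) s)"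
    by (rule h_along_continuous) (use H1_pathD(4)[OF p] t in auto)
  have g: "set_integrable lborel {t..T} (\<lambda>s. 1/2 * (g s)\<^sup>2)"
    using p unfolding H1_path_def by (auto intro: set_integrable_mult_right)
  have hi: "set_integrable lborel {t..T} (\<lambda>s. h (\<gamma> s) s)"
    by (rule borel_integrable_atLeastAtMost'[OF c])
  show ?thesis
    unfolding action_def
    by (subst set_integral_add(2)[OF g hi])
       (simp only: set_borel_integral_eq_integral(2)[OF g] set_borel_integral_eq_integral(2)[OF hi]
        Henstock_Kurzweil_Integration.integral_mult_right)
qed

lemma action_lower_bound:
  assumes p: "H1_path t T \<gamma> g" and t: "0 \<le> t" "t \<le> T"
  shows "action h t T \<gamma> g \<ge> - M * (T - t)"
proof -
  have "integral {t..T} (\<lambda>s. (g s)\<^sup>2) \<ge> 0"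
    by (rule Henstock_Kurzweil_Integration.integral_nonneg) (use H1_pathD[OF p] in auto)
  moreover have "integral {t..T} (\<lambda>s. - M) \<le> integral {t..T} (\<lambda>s. h (\<gamma> s) s)"
  proof (rule integral_le)
    show "(\<lambda>s. h (\<gamma> s) s) integrable_on {t..T}"
      by (rule h_along_integrable) (use H1_pathD(4)[OF p] t in auto)
    fix s assume "s \<in> {t..T}"
    then show "- M \<le> h (\<gamma> s) s" using h_bdd[of s "\<gamma> s"] t by auto
  qed (rule integrable_const_ivl)
  ultimately show ?thesis unfolding action_eq[OF p t(1)] using t by (simp add: algebra_simps)
qed

lemma M_nonneg: "t \<in> {0..T} \<Longrightarrow> 0 \<le> M"
  using h_bdd[of t 0] by auto

text \<open>\<open>Inf\<close> on the reals acts as an infimum only for nonempty sets bounded below.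
  Boundedness comes from the bounds on h and on the terminal values; the constant path gives
  nonemptiness where it is required.\<close>

lemma cost_set_bdd_below:
  assumes "0 \<le> t" "t \<le> T"
  shows "bdd_below {action h t T \<gamma> g + v (\<gamma> T) T | \<gamma> g. H1_path t T \<gamma> g \<and> \<gamma> t = x}"
proof (rule bdd_belowI)
  fix y assume "y \<in> {action h t T \<gamma> g + v (\<gamma> T) T | \<gamma> g. H1_path t T \<gamma> g \<and> \<gamma> t = x}"
  then obtain \<gamma> g where "y = action h t T \<gamma> g + v (\<gamma> T) T" "H1_path t T \<gamma> g" by auto
  then show "- M * (T - t) - B \<le> y"
    using action_lower_bound[of t \<gamma> g] v_bdd[of T "\<gamma> T"] assms by auto
qed

lemma value_le_action:
  assumes "0 \<le> t" "t \<le> T" "H1_path t T \<gamma> g"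
  shows "v (\<gamma> t) t \<le> action h t T \<gamma> g + v (\<gamma> T) T"
proof -
  have "v (\<gamma> t) t = Inf {action h t T \<gamma>' g' + v (\<gamma>' T) T | \<gamma>' g'. H1_path t T \<gamma>' g' \<and> \<gamma>' t = \<gamma> t}"
    by (rule v_repr[unfolded value_repr_def, rule_format]) (use assms in auto)
  also have "\<dots> \<le> action h t T \<gamma> g + v (\<gamma> T) T"
    by (rule cInf_lower[OF _ cost_set_bdd_below]) (use assms in auto)
  finally show ?thesis .
qed

lemma near_minimizer:
  assumes "0 \<le> t" "t \<le> T" "\<epsilon> > 0"
  obtains \<gamma> g where "H1_path t T \<gamma> g" "\<gamma> t = x" "action h t T \<gamma> g + v (\<gamma> T) T \<le> v x t + \<epsilon>"
proof -
  let ?S = "{action h t T \<gamma> g + v (\<gamma> T) T | \<gamma> g. H1_path t T \<gamma> g \<and> \<gamma> t = x}"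
  have eq: "v x t = Inf ?S"
    by (rule v_repr[unfolded value_repr_def, rule_format]) (use assms in auto)
  have "H1_path t T (\<lambda>_. x) (\<lambda>_. 0)" unfolding H1_path_def by (simp add: set_integrable_def)
  then have "?S \<noteq> {}" by fastforce
  moreover have "Inf ?S < v x t + \<epsilon>" unfolding eq[symmetric] using assms by simp
  ultimately have "\<exists>y\<in>?S. y < v x t + \<epsilon>"
    by (subst (asm) cInf_less_iff[OF _ cost_set_bdd_below[OF assms(1,2)]])
  then obtain \<gamma> g where "H1_path t T \<gamma> g" "\<gamma> t = x"
    "action h t T \<gamma> g + v (\<gamma> T) T < v x t + \<epsilon>"
    by blast
  then show ?thesis by (intro that[of \<gamma> g]) simp_all
qed

text \<open>One half of dynamic programming, for straight initial segments: follow the segment to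
  (y, t1), then a near-minimal path from there.\<close>

lemma value_le_line:
  assumes t: "0 \<le> t" "t < t1" "t1 \<le> T" and c: "c = (y - x) / (t1 - t)"
  shows "v x t \<le> c\<^sup>2 * (t1 - t) / 2 + integral {t..t1} (\<lambda>s. h (x + c * (s - t)) s) + v y t1"
proof (rule field_le_epsilon)
  fix \<epsilon> :: real assume "\<epsilon> > 0"
  obtain \<gamma> g where p: "H1_path t1 T \<gamma> g" and gy: "\<gamma> t1 = y"
    and le: "action h t1 T \<gamma> g + v (\<gamma> T) T \<le> v y t1 + \<epsilon>"
    by (rule near_minimizer[of t1 \<epsilon> y]) (use t \<open>\<epsilon> > 0\<close> in auto)
  define \<gamma>' g' where "\<gamma>' s = (if s \<le> t1 then x + c * (s - t) else \<gamma> s)"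
    and "g' s = (if s \<le> t1 then c else g s)" for s
  have end_eq: "x + c * (t1 - t) = y" using c t by simp
  have U: "{t..T} = {t..t1} \<union> {t1<..T}" using t by auto
  \<comment> \<open>Stated for an arbitrary F so that it yields integrability of both
    \<open>g'\<close> and its square; \<open>first\<close> and \<open>second\<close> are general for
    the same reason.\<close>
  have I: "set_integrable lborel {t..T} (\<lambda>s. F (g' s))"
    if "set_integrable lborel {t1..T} (\<lambda>s. F (g s))" for F :: "real \<Rightarrow> real"
    unfolding U
  proof (rule set_integrable_Un)
    have "set_integrable lborel {t..t1} (\<lambda>s. F c)"
      by (rule borel_integrable_atLeastAtMost') simp
    then show "set_integrable lborel {t..t1} (\<lambda>s. F (g' s))"
      by (rule set_integrable_cong[THEN iffD1, rotated -1]) (auto simp: g'_def)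
    have "set_integrable lborel {t1<..T} (\<lambda>s. F (g s))"
      by (rule set_integrable_subset[OF that]) auto
    then show "set_integrable lborel {t1<..T} (\<lambda>s. F (g' s))"
      by (rule set_integrable_cong[THEN iffD1, rotated -1]) (auto simp: g'_def)
  qed auto
  have g': "set_integrable lborel {t..T} g'" "set_integrable lborel {t..T} (\<lambda>s. (g' s)\<^sup>2)"
    using I[of "\<lambda>x. x"] I[of "\<lambda>x. x\<^sup>2"] p unfolding H1_path_def by auto
  note gi = set_borel_integral_eq_integral(1)[OF g'(1)] set_borel_integral_eq_integral(1)[OF g'(2)]
  have first: "integral {t..s} (\<lambda>s. F (g' s)) = (s - t) * F c"
    if "s \<in> {t..t1}" for s and F :: "real \<Rightarrow> real"
  proof -
    have "integral {t..s} (\<lambda>s. F (g' s)) = integral {t..s} (\<lambda>s. F c)"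
      by (rule Henstock_Kurzweil_Integration.integral_cong) (use that in \<open>auto simp: g'_def\<close>)
    then show ?thesis using that by simp
  qed
  \<comment> \<open>At the junction \<open>t1\<close> the derivative \<open>g'\<close> takes the
    value c, not \<open>g t1\<close>; a single point does not affect the integral.\<close>
  have second: "integral {t1..s} (\<lambda>s. F (g' s)) = integral {t1..s} (\<lambda>s. F (g s))"
    for s and F :: "real \<Rightarrow> real"
    by (rule integral_spike[of "{t1}"]) (auto simp: g'_def)
  have p': "H1_path t T \<gamma>' g'"
    unfolding H1_path_def
  proof (intro conjI g' ballI)
    fix s assume s: "s \<in> {t..T}"
    have "set_lebesgue_integral lborel {t..s} g' = integral {t..s} g'"
      by (rule set_borel_integral_eq_integral(2), rule set_integrable_subset[OF g'(1)]) (use s in auto)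
    moreover have "\<gamma>' s = \<gamma>' t + integral {t..s} g'"
    proof (cases "s \<le> t1")
      case True
      then show ?thesis using first[of s "\<lambda>x. x"] s by (simp add: \<gamma>'_def)
    next
      case False
      have "integral {t..t1} g' + integral {t1..s} g' = integral {t..s} g'"
        by (rule Henstock_Kurzweil_Integration.integral_combine)
           (use s t False in \<open>auto intro!: integrable_subinterval_real[OF gi(1)]\<close>)
      then show ?thesis
        using first[of t1 "\<lambda>x. x"] second[of s "\<lambda>x. x"] H1_pathD(3)[OF p, of s] False s t gy end_eq
        by (simp add: \<gamma>'_def algebra_simps)
    qed
    ultimately show "\<gamma>' s = \<gamma>' t + set_lebesgue_integral lborel {t..s} g'" by simp
  qed
  have hi: "(\<lambda>s. h (\<gamma>' s) s) integrable_on {t..T}"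
    by (rule h_along_integrable) (use H1_pathD(4)[OF p'] t in auto)
  have "action h t T \<gamma>' g' = c\<^sup>2 * (t1 - t) / 2 + integral {t..t1} (\<lambda>s. h (x + c * (s - t)) s)
     + action h t1 T \<gamma> g"
  proof -
    have "integral {t..T} (\<lambda>s. (g' s)\<^sup>2)
        = (t1 - t) * c\<^sup>2 + integral {t1..T} (\<lambda>s. (g s)\<^sup>2)"
      using Henstock_Kurzweil_Integration.integral_combine[OF _ _ gi(2), of t1]
        first[of t1 "\<lambda>x. x\<^sup>2"] second[of T "\<lambda>x. x\<^sup>2"] t by simp
    moreover have "integral {t..T} (\<lambda>s. h (\<gamma>' s) s)
        = integral {t..t1} (\<lambda>s. h (x + c * (s - t)) s) + integral {t1..T} (\<lambda>s. h (\<gamma> s) s)"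
    proof -
      have "integral {t..t1} (\<lambda>s. h (\<gamma>' s) s) = integral {t..t1} (\<lambda>s. h (x + c * (s - t)) s)"
        by (rule Henstock_Kurzweil_Integration.integral_cong) (auto simp: \<gamma>'_def)
      moreover have "integral {t1..T} (\<lambda>s. h (\<gamma>' s) s) = integral {t1..T} (\<lambda>s. h (\<gamma> s) s)"
        by (rule Henstock_Kurzweil_Integration.integral_cong)
           (use gy end_eq in \<open>auto simp: \<gamma>'_def\<close>)
      ultimately show ?thesis
        using Henstock_Kurzweil_Integration.integral_combine[OF _ _ hi, of t1] t by simp
    qed
    ultimately show ?thesis
      using action_eq[OF p'] action_eq[OF p] t by (simp add: field_simps)
  qed
  \<comment> \<open>If T = t1 the terminal point lies on the line branch of
    \<open>\<gamma>'\<close>, and the two branches agree there because the line ends at y.\<close>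
  moreover have "\<gamma>' t = x" "\<gamma>' T = \<gamma> T"
    using t gy end_eq by (cases "T = t1"; simp add: \<gamma>'_def)+
  ultimately show "v x t \<le> c\<^sup>2 * (t1 - t) / 2 + integral {t..t1} (\<lambda>s. h (x + c * (s - t)) s) + v y t1 + \<epsilon>"
    using value_le_action[OF _ _ p'] le t by force
qed

text \<open>The other half of dynamic programming: cut a near-minimal path at t1 and bound the cost
  of its tail from below by the value at the cutting point.\<close>

lemma near_minimizer_initial:
  assumes t: "0 \<le> t" "t \<le> t1" "t1 \<le> T" and "\<epsilon> > 0"
  obtains \<gamma> g where "H1_path t t1 \<gamma> g" "\<gamma> t = x"
    "1/2 * integral {t..t1} (\<lambda>s. (g s)\<^sup>2) + integral {t..t1} (\<lambda>s. h (\<gamma> s) s) + v (\<gamma> t1) t1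
      \<le> v x t + \<epsilon>"
proof -
  obtain \<gamma> g where p: "H1_path t T \<gamma> g" and gx: "\<gamma> t = x"
    and le: "action h t T \<gamma> g + v (\<gamma> T) T \<le> v x t + \<epsilon>"
    by (rule near_minimizer[of t \<epsilon> x]) (use assms in auto)
  have p1: "H1_path t1 T \<gamma> g" by (rule H1_path_subinterval[OF p]) (use t in auto)
  have p0: "H1_path t t1 \<gamma> g" by (rule H1_path_subinterval[OF p]) (use t in auto)
  have hi: "(\<lambda>s. h (\<gamma> s) s) integrable_on {t..T}"
    by (rule h_along_integrable) (use H1_pathD(4)[OF p] t in auto)
  have "action h t T \<gamma> g = 1/2 * integral {t..t1} (\<lambda>s. (g s)\<^sup>2) + integral {t..t1} (\<lambda>s. h (\<gamma> s) s)
     + action h t1 T \<gamma> g"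
    using Henstock_Kurzweil_Integration.integral_combine[OF _ _ hi, of t1]
      Henstock_Kurzweil_Integration.integral_combine[OF _ _ H1_pathD(2)[OF p], of t1] t
      action_eq[OF p] action_eq[OF p1] by simp
  moreover have "v (\<gamma> t1) t1 \<le> action h t1 T \<gamma> g + v (\<gamma> T) T"
    by (rule value_le_action[OF _ _ p1]) (use t in auto)
  ultimately show ?thesis using le by (intro that[OF p0 gx]) simp
qed


section \<open>Speed and straightness of near-minimal paths\<close>

lemma holder_on_box:
  assumes "0 < a" "b < T"
  obtains H where "0 \<le> H"
    "\<And>x y s t. \<lbrakk>\<bar>x\<bar> \<le> R; \<bar>y\<bar> \<le> R; s \<in> {a..b}; t \<in> {a..b}\<rbrakk>
      \<Longrightarrow> \<bar>h x s - h y t\<bar> \<le> H * (\<bar>x - y\<bar> + \<bar>s - t\<bar>) powr \<beta>"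
proof -
  let ?K = "{-R..R} \<times> {a..b}"
  have "compact ?K" "?K \<subseteq> UNIV \<times> {0<..<T}"
    using assms by (auto intro: compact_Times)
  then obtain C where C: "\<And>p q. p \<in> ?K \<Longrightarrow> q \<in> ?K \<Longrightarrow>
      \<bar>(\<lambda>(x, t). h x t) p - (\<lambda>(x, t). h x t) q\<bar> \<le> C * dist p q powr \<beta>"
    using h_holder unfolding locally_holder_on_def by meson
  show ?thesis
  \<comment> \<open>On a box with at most one point the constant C may be negative, hence the
    maximum.\<close>
  proof (rule that[of "max C 0"])
    fix x y s t assume "\<bar>x\<bar> \<le> R" "\<bar>y\<bar> \<le> R" "s \<in> {a..b}" "t \<in> {a..b}"
    then have "\<bar>h x s - h y t\<bar> \<le> C * dist (x, s) (y, t) powr \<beta>"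
      using C[of "(x, s)" "(y, t)"] by (auto simp: abs_le_iff)
    also have "\<dots> \<le> max C 0 * (\<bar>x - y\<bar> + \<bar>s - t\<bar>) powr \<beta>"
    proof (intro mult_mono powr_mono2)
      show "dist (x, s) (y, t) \<le> \<bar>x - y\<bar> + \<bar>s - t\<bar>"
        by (simp add: dist_prod_def dist_real_def sqrt_sum_squares_le_sum_abs)
    qed (use beta in auto)
    finally show "\<bar>h x s - h y t\<bar> \<le> max C 0 * (\<bar>x - y\<bar> + \<bar>s - t\<bar>) powr \<beta>" .
  qed simp
qed

lemma v_lipschitz:
  assumes "s \<in> {0..T}" "t \<in> {0..T}"
  shows "\<bar>v x s - v y t\<bar> \<le> L * (\<bar>x - y\<bar> + \<bar>s - t\<bar>)"
proof -
  have "\<bar>v x s - v y t\<bar> \<le> L * dist (x, s) (y, t)"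
    using lipschitz_onD[OF v_lip, of "(x, s)" "(y, t)"] assms by (simp add: dist_real_def)
  also have "\<dots> \<le> L * (\<bar>x - y\<bar> + \<bar>s - t\<bar>)"
    using lipschitz_on_nonneg[OF v_lip]
    by (intro mult_left_mono)
       (simp_all add: dist_prod_def dist_real_def sqrt_sum_squares_le_sum_abs)
  finally show ?thesis .
qed

text \<open>Its square bounds the mean of the squared velocity of a near-minimal path: M comes from
  the running cost, L from the change of v in time, \<open>L\<^sup>2\<close> from absorbing the
  change of v in space, and 1 from the slack.\<close>

definition speed_bound :: real where
  "speed_bound = sqrt (4 * (M + L + L\<^sup>2 + 1))"

text \<open>By the Lipschitz bound, ending at distance d gains at most L * d, whereas the energy A
  satisfies d^2 \<le> \<tau> * A. Large A therefore costs more than it gains, and A is at most a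
  constant times \<tau>.\<close>

lemma near_minimizer_displacement:
  assumes p: "H1_path t t1 \<gamma> g" and t: "0 \<le> t" "t < t1" "t1 \<le> T"
    and le: "1/2 * integral {t..t1} (\<lambda>s. (g s)\<^sup>2) + integral {t..t1} (\<lambda>s. h (\<gamma> s) s) + v (\<gamma> t1) t1
      \<le> v (\<gamma> t) t + (t1 - t)"
    and s: "s \<in> {t..t1}"
  shows "\<bar>\<gamma> s - \<gamma> t\<bar> \<le> speed_bound * (t1 - t)"
proof -
  define \<tau> where "\<tau> = t1 - t"
  define A where "A = integral {t..t1} (\<lambda>s. (g s)\<^sup>2)"
  have \<tau>: "\<tau> > 0" using t by (simp add: \<tau>_def)
  have M0: "0 \<le> M" by (rule M_nonneg[of t]) (use t in auto)
  have L0: "0 \<le> L" by (rule lipschitz_on_nonneg[OF v_lip])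
  have disp: "(\<gamma> s - \<gamma> t)\<^sup>2 \<le> \<tau> * A" if s: "s \<in> {t..t1}" for s
  proof -
    have ps: "H1_path t s \<gamma> g" by (rule H1_path_subinterval[OF p]) (use s in auto)
    have "(\<gamma> s - \<gamma> t)\<^sup>2 = (integral {t..s} g)\<^sup>2"
      using H1_pathD(3)[OF p s] by simp
    also have "\<dots> \<le> (s - t) * integral {t..s} (\<lambda>s. (g s)\<^sup>2)"
      by (rule integral_square_le) (use s H1_pathD(1,2)[OF ps] in auto)
    also have "\<dots> \<le> \<tau> * A"
      unfolding A_def
      by (intro mult_mono integral_subset_le Henstock_Kurzweil_Integration.integral_nonneg)
         (use s H1_pathD(1,2)[OF p] H1_pathD(1,2)[OF ps] in \<open>auto simp: \<tau>_def\<close>)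
    finally show ?thesis .
  qed
  define d where "d = \<bar>\<gamma> t - \<gamma> t1\<bar>"
  have "integral {t..t1} (\<lambda>s. - M) \<le> integral {t..t1} (\<lambda>s. h (\<gamma> s) s)"
  proof (rule integral_le)
    show "(\<lambda>s. h (\<gamma> s) s) integrable_on {t..t1}"
      by (rule h_along_integrable) (use H1_pathD(4)[OF p] t in auto)
    fix s assume "s \<in> {t..t1}"
    then show "- M \<le> h (\<gamma> s) s" using h_bdd[of s "\<gamma> s"] t by auto
  qed (rule integrable_const_ivl)
  then have "- M * \<tau> \<le> integral {t..t1} (\<lambda>s. h (\<gamma> s) s)"
    using t by (simp add: \<tau>_def algebra_simps)
  moreover have "v (\<gamma> t) t - v (\<gamma> t1) t1 \<le> L * (d + \<tau>)"
    using v_lipschitz[of t t1 "\<gamma> t" "\<gamma> t1"] t by (simp add: d_def \<tau>_def abs_minus_commute)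
  ultimately have "A \<le> 2 * (M * \<tau> + L * \<tau> + L * d + \<tau>)"
    using le by (simp add: A_def \<tau>_def algebra_simps)
  moreover have "L * d \<le> L\<^sup>2 * \<tau> + A / 4"
  proof -
    have d2: "d\<^sup>2 \<le> \<tau> * A" using disp[of t1] t by (simp add: d_def power2_commute)
    \<comment> \<open>Young's inequality, weighted so that the term 2 * L * d in the energy bound
      absorbs exactly half of A.\<close>
    have "0 \<le> (2 * L * \<tau> - d)\<^sup>2" by simp
    then have "4 * \<tau> * (L * d) \<le> 4 * \<tau> * (L\<^sup>2 * \<tau>) + d\<^sup>2"
      by (simp add: power2_eq_square algebra_simps)
    also have "\<dots> \<le> 4 * \<tau> * (L\<^sup>2 * \<tau> + A / 4)"
      using d2 by (simp add: algebra_simps)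
    finally show ?thesis using \<tau> by simp
  qed
  ultimately have A: "A \<le> speed_bound\<^sup>2 * \<tau>"
    using M0 L0 by (simp add: speed_bound_def algebra_simps)
  have "(\<gamma> s - \<gamma> t)\<^sup>2 \<le> \<tau> * (speed_bound\<^sup>2 * \<tau>)"
    using disp[OF s] A \<tau> by (meson mult_left_mono order_less_imp_le order_trans)
  then have "\<bar>\<gamma> s - \<gamma> t\<bar>\<^sup>2 \<le> (speed_bound * \<tau>)\<^sup>2"
    by (simp add: power2_eq_square mult_ac)
  moreover have "0 \<le> speed_bound * \<tau>" using M0 L0 \<tau> by (simp add: speed_bound_def)
  ultimately show "\<bar>\<gamma> s - \<gamma> t\<bar> \<le> speed_bound * (t1 - t)"
    unfolding \<tau>_def by (rule power2_le_imp_le)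
qed

text \<open>The excess of the kinetic energy over that of the straight line controls the deviation from
  the line, while minimality and the Hoelder continuity of h bound the excess by a power of the
  deviation.\<close>

lemma near_minimizer_deviation:
  assumes p: "H1_path t t1 \<gamma> g" and t: "0 \<le> t" "t1 \<le> T"
    and r: "0 < r" and t1: "t1 - t = r powr (1 - \<beta> / 2)" and H: "0 \<le> H"
    and le: "1/2 * integral {t..t1} (\<lambda>s. (g s)\<^sup>2) + integral {t..t1} (\<lambda>s. h (\<gamma> s) s) + v (\<gamma> t1) t1
      \<le> v (\<gamma> t) t + r powr (1 + \<beta> / 2)"
    and c: "c = (\<gamma> t1 - \<gamma> t) / (t1 - t)"
    and hold: "\<And>s. s \<in> {t..t1} \<Longrightarrow>
      \<bar>h (\<gamma> t + c * (s - t)) s - h (\<gamma> s) s\<bar> \<le> H * \<bar>\<gamma> s - (\<gamma> t + c * (s - t))\<bar> powr \<beta>"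
    and s: "s \<in> {t..t1}"
  shows "\<bar>\<gamma> s - (\<gamma> t + c * (s - t))\<bar> \<le> (2 * H + 2) * r"
proof -
  define \<tau> where "\<tau> = t1 - t"
  define \<epsilon> where "\<epsilon> = r powr (1 + \<beta> / 2)"
  have \<tau>: "\<tau> > 0" using r t1 by (simp add: \<tau>_def)
  define E where "E = integral {t..t1} (\<lambda>s. (g s - c)\<^sup>2)"
  note pd = H1_pathD[OF p]
  \<comment> \<open>The chord velocity c is the mean of g, so the variance E below is exactly the
    kinetic energy in excess of the chord's.\<close>
  have ct: "integral {t..t1} g = c * \<tau>"
    using pd(3)[of t1] \<tau> c by (simp add: \<tau>_def)
  have sq: "((\<lambda>s. (g s - c)\<^sup>2) has_integral
      integral {t..t1} (\<lambda>s. (g s)\<^sup>2) - c\<^sup>2 * \<tau>) {t..t1}"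
    using integral_square_diff_const[OF _ pd(1,2), of c] \<tau> unfolding ct
    by (simp add: \<tau>_def power2_eq_square algebra_simps)
  then have E: "E = integral {t..t1} (\<lambda>s. (g s)\<^sup>2) - c\<^sup>2 * \<tau>"
    unfolding E_def by (rule integral_unique)
  have E0: "0 \<le> E" unfolding E_def
    by (rule Henstock_Kurzweil_Integration.integral_nonneg) (use sq in auto)
  \<comment> \<open>Cauchy-Schwarz bounds the deviation by this quantity at all times at once, so
    the Hoelder estimate can be applied uniformly along the path.\<close>
  define \<delta> where "\<delta> = sqrt (\<tau> * E)"
  have \<delta>2: "\<delta>\<^sup>2 = \<tau> * E" and \<delta>0: "0 \<le> \<delta>" using \<tau> E0 by (simp_all add: \<delta>_def)
  have dev: "\<bar>\<gamma> s - (\<gamma> t + c * (s - t))\<bar> \<le> \<delta>" if s: "s \<in> {t..t1}" for s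
  proof -
    have ps: "H1_path t s \<gamma> g" by (rule H1_path_subinterval[OF p]) (use s in auto)
    have sqs: "(\<lambda>s. (g s - c)\<^sup>2) integrable_on {t..s}"
      using integral_square_diff_const[OF _ H1_pathD(1,2)[OF ps], of c] s by auto
    have gc: "(\<lambda>s. g s - c) integrable_on {t..s}"
      by (intro integrable_diff H1_pathD(1)[OF ps] integrable_const_ivl)
    have "integral {t..s} (\<lambda>s. g s - c) = integral {t..s} g - c * (s - t)"
      using s by (subst Henstock_Kurzweil_Integration.integral_diff)
        (auto intro: H1_pathD(1,2)[OF ps] integrable_const_ivl)
    then have "\<bar>\<gamma> s - (\<gamma> t + c * (s - t))\<bar>\<^sup>2 = (integral {t..s} (\<lambda>s. g s - c))\<^sup>2"
      using pd(3)[OF s] by simp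
    also have "\<dots> \<le> (s - t) * integral {t..s} (\<lambda>s. (g s - c)\<^sup>2)"
      by (rule integral_square_le) (use s gc sqs in auto)
    also have "\<dots> \<le> \<tau> * E"
      unfolding E_def
      by (intro mult_mono integral_subset_le Henstock_Kurzweil_Integration.integral_nonneg)
         (use s sq sqs in \<open>auto simp: \<tau>_def\<close>)
    finally have "\<bar>\<gamma> s - (\<gamma> t + c * (s - t))\<bar>\<^sup>2 \<le> \<delta>\<^sup>2" unfolding \<delta>2 .
    then show ?thesis by (rule power2_le_imp_le[OF _ \<delta>0])
  qed
  have ch: "(\<lambda>s. h (\<gamma> s) s) integrable_on {t..t1}"
    and cl: "(\<lambda>s. h (\<gamma> t + c * (s - t)) s) integrable_on {t..t1}"
    by (rule h_along_integrable; use pd(4) t in \<open>auto intro!: continuous_intros\<close>)+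
  have "v (\<gamma> t) t \<le> c\<^sup>2 * \<tau> / 2 + integral {t..t1} (\<lambda>s. h (\<gamma> t + c * (s - t)) s) + v (\<gamma> t1) t1"
    unfolding \<tau>_def by (rule value_le_line) (use t \<tau> c in \<open>auto simp: \<tau>_def\<close>)
  then have "E / 2 \<le> integral {t..t1} (\<lambda>s. h (\<gamma> t + c * (s - t)) s)
      - integral {t..t1} (\<lambda>s. h (\<gamma> s) s) + \<epsilon>"
    using le unfolding E \<epsilon>_def by simp
  also have "integral {t..t1} (\<lambda>s. h (\<gamma> t + c * (s - t)) s) - integral {t..t1} (\<lambda>s. h (\<gamma> s) s)
      \<le> H * \<delta> powr \<beta> * \<tau>"
  proof -
    have "integral {t..t1} (\<lambda>s. h (\<gamma> t + c * (s - t)) s)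
        \<le> integral {t..t1} (\<lambda>s. h (\<gamma> s) s + H * \<delta> powr \<beta>)"
    proof (rule integral_le[OF cl])
      show "(\<lambda>s. h (\<gamma> s) s + H * \<delta> powr \<beta>) integrable_on {t..t1}"
        by (intro Henstock_Kurzweil_Integration.integrable_add ch integrable_const_ivl)
      fix s assume s: "s \<in> {t..t1}"
      have "H * \<bar>\<gamma> s - (\<gamma> t + c * (s - t))\<bar> powr \<beta> \<le> H * \<delta> powr \<beta>"
        using dev[OF s] H beta by (intro mult_left_mono powr_mono2) auto
      then show "h (\<gamma> t + c * (s - t)) s \<le> h (\<gamma> s) s + H * \<delta> powr \<beta>"
        using hold[OF s] by linarith
    qed
    also have "\<dots> = integral {t..t1} (\<lambda>s. h (\<gamma> s) s) + H * \<delta> powr \<beta> * \<tau>"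
      using ch \<tau> by (subst Henstock_Kurzweil_Integration.integral_add)
        (auto intro: integrable_const_ivl simp: \<tau>_def)
    finally show ?thesis by simp
  qed
  finally have "E \<le> 2 * (H * \<delta> powr \<beta> * \<tau> + \<epsilon>)" by simp
  then have "\<delta>\<^sup>2 \<le> \<tau> * (2 * (H * \<delta> powr \<beta> * \<tau> + \<epsilon>))"
    unfolding \<delta>2 using \<tau> by (intro mult_left_mono) auto
  also have "\<dots> = 2 * H * (\<tau> * \<tau>) * \<delta> powr \<beta> + 2 * (\<tau> * \<epsilon>)" by (simp add: algebra_simps)
  \<comment> \<open>The choices of \<tau> and \<epsilon> are made for these two identities: both
    terms become homogeneous of degree 2 when \<delta> scales like r.\<close>
  also have "\<tau> * \<tau> = r powr (2 - \<beta>)" by (simp add: \<tau>_def t1 flip: powr_add)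
  also have "\<tau> * \<epsilon> = r\<^sup>2" using r by (simp add: \<tau>_def t1 \<epsilon>_def flip: powr_add)
  finally have "\<delta> \<le> (2 * H + 2) * r"
    by (rule bootstrap_bound[OF r H less_imp_le[OF beta(2)]])
  then show ?thesis using dev[OF s] by simp
qed

section \<open>One-sided affine bounds on the value function\<close>

lemma speed_bound_nonneg: "t \<in> {0..T} \<Longrightarrow> 0 \<le> speed_bound"
  unfolding speed_bound_def using M_nonneg lipschitz_on_nonneg[OF v_lip] by simp

text \<open>Three sources of error: the quadratic remainder of the kinetic energy, the variation of
  h between nearby paths over a duration of at most 2 * \<tau>, and the slack of the
  near-minimizer.\<close>

definition slope_error :: "real \<Rightarrow> real" where
  "slope_error H = (speed_bound + 1)\<^sup>2 + 2 * H * (2 * speed_bound + 2 * H + 4) + 1"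

text \<open>The endpoint y of a near-minimal path stays fixed while its starting point moves. The
  cost of the straight line from the moved point is expanded in (k, l), and the cost of the original
  path bounds v x t from below.\<close>

lemma value_increment_le:
  assumes H: "0 \<le> H"
    and hold: "\<And>x y s t. \<lbrakk>\<bar>x\<bar> \<le> R; \<bar>y\<bar> \<le> R; s \<in> {a..b}; t \<in> {a..b}\<rbrakk>
      \<Longrightarrow> \<bar>h x s - h y t\<bar> \<le> H * (\<bar>x - y\<bar> + \<bar>s - t\<bar>) powr \<beta>"
    and r: "0 < r" "r \<le> 1" "2 * r \<le> r powr (1 - \<beta> / 2)"
    and t: "0 \<le> a" "a \<le> t - r" "t + r powr (1 - \<beta> / 2) \<le> b" "b \<le> T"
    and x: "\<bar>x\<bar> + 2 * speed_bound + 1 \<le> R"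
  obtains p q where "\<And>k l. \<lbrakk>\<bar>k\<bar> \<le> r; \<bar>l\<bar> \<le> r\<rbrakk> \<Longrightarrow>
      v (x + k) (t + l) - v x t \<le> p * k + q * l + slope_error H * r powr (1 + \<beta> / 2)"
proof -
  define \<tau> where "\<tau> = r powr (1 - \<beta> / 2)"
  define \<epsilon> where "\<epsilon> = r powr (1 + \<beta> / 2)"
  define t1 where "t1 = t + \<tau>"
  define N where "N = speed_bound"
  have \<tau>: "0 < \<tau>" "2 * r \<le> \<tau>" using r by (auto simp: \<tau>_def)
  have \<tau>1: "\<tau> \<le> 1" using r beta powr_mono'[of 0 "1 - \<beta> / 2" r] by (simp add: \<tau>_def)
  have \<epsilon>: "0 < \<epsilon>" using r by (auto simp: \<epsilon>_def)
  have "\<epsilon> \<le> \<tau>" unfolding \<epsilon>_def \<tau>_def by (rule powr_mono') (use r beta in auto)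
  have tt: "0 \<le> t" "t < t1" "t1 \<le> b" "t1 \<le> T" "t1 - t = \<tau>" using t r \<tau> by (auto simp: t1_def \<tau>_def)
  have N0: "0 \<le> N" using speed_bound_nonneg[of t] tt by (auto simp: N_def)
  obtain \<gamma> g where p: "H1_path t t1 \<gamma> g" and gx: "\<gamma> t = x"
    and le: "1/2 * integral {t..t1} (\<lambda>s. (g s)\<^sup>2) + integral {t..t1} (\<lambda>s. h (\<gamma> s) s) + v (\<gamma> t1) t1
      \<le> v x t + \<epsilon>"
    by (rule near_minimizer_initial[of t t1 \<epsilon> x]) (use tt \<epsilon> in auto)
  define y where "y = \<gamma> t1"
  define c where "c = (y - x) / \<tau>"
  have y: "y = x + c * \<tau>" using \<tau> by (simp add: c_def)
  have disp: "\<bar>\<gamma> s - x\<bar> \<le> N * \<tau>" if "s \<in> {t..t1}" for s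
    unfolding N_def gx[symmetric] tt(5)[symmetric]
    by (rule near_minimizer_displacement[OF p _ _ _ _ that])
       (use tt le gx \<open>\<epsilon> \<le> \<tau>\<close> in auto)
  have "\<bar>c\<bar> * \<tau> = \<bar>y - x\<bar>" using \<tau> by (simp add: c_def abs_divide)
  also have "\<dots> \<le> N * \<tau>" using disp[of t1] tt by (simp add: y_def)
  finally have cN: "\<bar>c\<bar> \<le> N" using \<tau> by simp
  have ell: "\<bar>c * (s - t)\<bar> \<le> N * \<rho>" if "\<bar>s - t\<bar> \<le> \<rho>" for s \<rho>
    unfolding abs_mult using cN that N0 by (intro mult_mono) auto
  have N\<tau>: "N * \<tau> \<le> N" using N0 \<tau>1 by (simp add: mult_left_le)
  have Nr: "N * r \<le> N" using N0 r by (simp add: mult_left_le)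
  have xR: "\<bar>x\<bar> + 2 * N + 1 \<le> R" using x by (simp add: N_def)
  have dev: "\<bar>\<gamma> s - (x + c * (s - t))\<bar> \<le> (2 * H + 2) * r" if s: "s \<in> {t..t1}" for s
    unfolding gx[symmetric]
  proof (rule near_minimizer_deviation[OF p _ _ r(1) _ H _ _ _ s])
    fix s assume s: "s \<in> {t..t1}"
    have "\<bar>h (x + c * (s - t)) s - h (\<gamma> s) s\<bar>
        \<le> H * (\<bar>(x + c * (s - t)) - \<gamma> s\<bar> + \<bar>s - s\<bar>) powr \<beta>"
    proof (rule hold)
      show "\<bar>x + c * (s - t)\<bar> \<le> R" using ell[of s \<tau>] s tt N\<tau> N0 xR by auto
      show "\<bar>\<gamma> s\<bar> \<le> R" using disp[OF s] N\<tau> N0 xR by auto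
    qed (use s tt t r in auto)
    then show "\<bar>h (\<gamma> t + c * (s - t)) s - h (\<gamma> s) s\<bar>
        \<le> H * \<bar>\<gamma> s - (\<gamma> t + c * (s - t))\<bar> powr \<beta>"
      by (simp add: gx abs_minus_commute)
  next
    show "c = (\<gamma> t1 - \<gamma> t) / (t1 - t)" unfolding gx tt(5) c_def y_def ..
  next
    show "t1 - t = r powr (1 - \<beta> / 2)" using tt(5) by (simp add: \<tau>_def)
  qed (use tt le in \<open>auto simp: gx \<epsilon>_def\<close>)
  \<comment> \<open>\<open>Q * r\<close> adds the separations that occur: new line to chord (N + 1)
    * r, chord to path (2 * H + 2) * r, chord to x within time r at most N * r, and the time shift
    r.\<close>
  define Q where "Q = 2 * N + 2 * H + 4"
  define e where "e = H * (Q * r powr \<beta>)"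
  have Q1: "1 \<le> Q" using N0 H by (simp add: Q_def)
  have e0: "0 \<le> e" using H Q1 by (simp add: e_def)
  have near: "\<bar>h X s - h Y s'\<bar> \<le> e"
    if "\<bar>X\<bar> \<le> R" "\<bar>Y\<bar> \<le> R" "s \<in> {a..b}" "s' \<in> {a..b}" "\<bar>X - Y\<bar> + \<bar>s - s'\<bar> \<le> Q * r" for X Y s s'
  proof -
    have "(\<bar>X - Y\<bar> + \<bar>s - s'\<bar>) powr \<beta> \<le> (Q * r) powr \<beta>"
      using that beta by (intro powr_mono2) auto
    also have "\<dots> = Q powr \<beta> * r powr \<beta>" using Q1 r by (simp add: powr_mult)
    also have "\<dots> \<le> Q powr 1 * r powr \<beta>"
      using Q1 beta by (intro mult_right_mono powr_mono) auto
    finally have "(\<bar>X - Y\<bar> + \<bar>s - s'\<bar>) powr \<beta> \<le> Q * r powr \<beta>" using Q1 by simp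
    then have "H * (\<bar>X - Y\<bar> + \<bar>s - s'\<bar>) powr \<beta> \<le> e"
      unfolding e_def using H by (rule mult_left_mono)
    then show ?thesis using hold[OF that(1-4)] by linarith
  qed
  show ?thesis
  \<comment> \<open>The slopes satisfy the Hamilton-Jacobi relation q = p^2 / 2 - h, with p the
    negative of the chord velocity.\<close>
  proof (rule that[of "- c" "c\<^sup>2 / 2 - h x t"])
    fix k l assume k: "\<bar>k\<bar> \<le> r" and l: "\<bar>l\<bar> \<le> r"
    \<comment> \<open>\<sigma> is the duration of the new line and w the amount by which its
      displacement differs from c * \<sigma>. The condition 2 * r \<le> \<tau> keeps \<sigma> at
      least \<tau> / 2.\<close>
    define \<sigma> where "\<sigma> = \<tau> - l"
    define w where "w = c * l - k"
    define c' where "c' = c + w / \<sigma>"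
    have \<sigma>: "0 < \<sigma>" "\<tau> \<le> 2 * \<sigma>" using l \<tau> by (auto simp: \<sigma>_def)
    have "\<bar>w\<bar> \<le> \<bar>c * l\<bar> + \<bar>k\<bar>" unfolding w_def by linarith
    also have "\<dots> \<le> N * r + r"
      unfolding abs_mult using k l cN N0 by (intro add_mono mult_mono) auto
    finally have w: "\<bar>w\<bar> \<le> (N + 1) * r" by (simp add: algebra_simps)
    have c's: "c' * \<sigma> = c * \<sigma> + w" using \<sigma> by (simp add: c'_def algebra_simps)
    have c'_eq: "c' = (y - (x + k)) / (t1 - (t + l))"
    proof -
      have "c' * \<sigma> = y - (x + k)" unfolding c's y by (simp add: \<sigma>_def w_def algebra_simps)
      moreover have "t1 - (t + l) = \<sigma>" by (simp add: t1_def \<sigma>_def)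
      ultimately show ?thesis using \<sigma> by (simp add: field_simps)
    qed
    define line where "line s = x + k + c' * (s - (t + l))" for s
    \<comment> \<open>Line and chord meet at time t1, so their gap is proportional to the remaining
      time u and is largest at the start, where it equals \<bar>w\<bar>.\<close>
    have line: "\<bar>line s - (x + c * (s - t))\<bar> \<le> (N + 1) * r" if "s \<in> {t + l..t1}" for s
    proof -
      define u where "u = t1 - s"
      have u: "0 \<le> u" "u \<le> \<sigma>" using that by (auto simp: u_def t1_def \<sigma>_def)
      have s: "s = t + \<tau> - u" by (simp add: u_def t1_def)
      have "line s - (x + c * (s - t)) = k + c' * (\<sigma> - u) - c * (\<tau> - u)"
        unfolding line_def s by (simp add: \<sigma>_def algebra_simps)
      also have "\<dots> = k + (c' * \<sigma> - c * \<tau>) - (c' - c) * u" by (simp add: algebra_simps)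
      also have "c' * \<sigma> - c * \<tau> = - k" unfolding c's by (simp add: \<sigma>_def w_def algebra_simps)
      also have "k + - k - (c' - c) * u = - (w / \<sigma>) * u" by (simp add: c'_def)
      finally have "\<bar>line s - (x + c * (s - t))\<bar> = \<bar>w\<bar> * (u / \<sigma>)"
        using u \<sigma> by (simp add: abs_mult)
      also have "\<dots> \<le> \<bar>w\<bar> * 1" using u \<sigma> by (intro mult_left_mono) auto
      finally show ?thesis using w by simp
    qed
    have Nr': "(N + 1) * r \<le> N + 1" using N0 r by (simp add: mult_left_le)
    \<comment> \<open>The chord strays at most N from x and the new line at most N + 1 from the
      chord, whence the margin \<open>2 * speed_bound + 1\<close> in the hypothesis on R.\<close>
    have in_R: "\<bar>line s\<bar> \<le> R" if "s \<in> {t + l..t1}" for s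
    proof -
      have "\<bar>s - t\<bar> \<le> \<tau>" using that l \<tau> by (auto simp: t1_def)
      then show ?thesis using line[OF that] ell[of s \<tau>] N\<tau> Nr' xR by linarith
    qed
    have \<gamma>_R: "\<bar>\<gamma> s\<bar> \<le> R" if "s \<in> {t..t1}" for s
      using disp[OF that] N\<tau> N0 xR by linarith
    have x_R: "\<bar>x\<bar> \<le> R" using N0 xR by linarith
    have Qr: "Q * r = (N + 1) * r + (2 * H + 2) * r + N * r + r" by (simp add: Q_def algebra_simps)
    have Hr: "0 \<le> (2 * H + 2) * r" "0 \<le> (N + 1) * r" "0 \<le> N * r" using H r N0 by auto
    have cont: "continuous_on {t + l..t1} line" unfolding line_def by (intro continuous_intros)
    have "integral {t + l..t1} (\<lambda>s. h (line s) s) - integral {t..t1} (\<lambda>s. h (\<gamma> s) s)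
        \<le> (t - (t + l)) * h x t + e * (t1 - min t (t + l))"
    proof (rule integral_shifted_le)
      show "(\<lambda>s. h (line s) s) integrable_on {t + l..t1}"
        by (rule h_along_integrable[OF cont]) (use l t tt in auto)
      show "(\<lambda>s. h (\<gamma> s) s) integrable_on {t..t1}"
        by (rule h_along_integrable[OF H1_pathD(4)[OF p]]) (use tt in auto)
    next
      fix s assume s: "t \<le> s" "t + l \<le> s" "s \<le> t1"
      have "\<bar>line s - \<gamma> s\<bar> \<le> (N + 1) * r + (2 * H + 2) * r"
        using line[of s] dev[of s] s by force
      then have d: "\<bar>line s - \<gamma> s\<bar> + \<bar>s - s\<bar> \<le> Q * r" unfolding Qr using Hr r by linarith
      have "s \<in> {a..b}" using s tt t r by simp
      then have "\<bar>h (line s) s - h (\<gamma> s) s\<bar> \<le> e"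
        using near[OF in_R \<gamma>_R _ _ d] s by simp
      then show "h (line s) s \<le> h (\<gamma> s) s + e" by linarith
    next
      fix s assume s: "t + l \<le> s" "s \<le> t"
      have st: "\<bar>s - t\<bar> \<le> r" and sab: "s \<in> {a..b}" "s \<in> {t + l..t1}" "t \<in> {a..b}"
        using s l t tt r by auto
      have "\<bar>line s - x\<bar> \<le> (N + 1) * r + N * r"
        using line[OF sab(2)] ell[OF st] by linarith
      then have d: "\<bar>line s - x\<bar> + \<bar>s - t\<bar> \<le> Q * r" unfolding Qr using Hr st by linarith
      have "\<bar>h (line s) s - h x t\<bar> \<le> e"
        by (rule near[OF in_R[OF sab(2)] x_R sab(1,3) d])
      then show "h (line s) s \<le> h x t + e" by linarith
    next
      fix s assume s: "t \<le> s" "s \<le> t + l"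
      have st: "\<bar>s - t\<bar> \<le> r" and st1: "s \<le> t1" using s l \<tau> r by (auto simp: t1_def)
      then have sab: "s \<in> {a..b}" "s \<in> {t..t1}" "t \<in> {a..b}"
        using s t tt r by auto
      have "\<bar>\<gamma> s - x\<bar> \<le> (2 * H + 2) * r + N * r"
        using dev[OF sab(2)] ell[OF st] by linarith
      then have d: "\<bar>\<gamma> s - x\<bar> + \<bar>s - t\<bar> \<le> Q * r" unfolding Qr using Hr st by linarith
      have "\<bar>h (\<gamma> s) s - h x t\<bar> \<le> e"
        by (rule near[OF \<gamma>_R[OF sab(2)] x_R sab(1,3) d])
      then show "h x t - e \<le> h (\<gamma> s) s" by linarith
    qed (use \<sigma> tt in \<open>auto simp: t1_def \<sigma>_def\<close>)
    also have "\<dots> \<le> - l * h x t + e * (2 * \<tau>)"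
      using e0 l \<tau> by (auto intro!: mult_left_mono simp: t1_def)
    finally have potential: "integral {t + l..t1} (\<lambda>s. h (line s) s)
        \<le> integral {t..t1} (\<lambda>s. h (\<gamma> s) s) - l * h x t + 2 * e * \<tau>" by simp
    have "c\<^sup>2 * \<tau> \<le> integral {t..t1} (\<lambda>s. (g s)\<^sup>2)"
    proof -
      have "integral {t..t1} g = c * \<tau>"
        using H1_pathD(3)[OF p, of t1] tt gx y by (simp add: y_def)
      then have "\<tau> * (c\<^sup>2 * \<tau>) \<le> \<tau> * integral {t..t1} (\<lambda>s. (g s)\<^sup>2)"
        using integral_square_le[OF _ H1_pathD(1,2)[OF p]] tt
        by (simp add: power2_eq_square mult_ac)
      then show ?thesis using \<tau> by simp
    qed
    then have lower: "c\<^sup>2 * \<tau> / 2 + integral {t..t1} (\<lambda>s. h (\<gamma> s) s) + v y t1 \<le> v x t + \<epsilon>"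
      using le by (simp add: y_def)
    have upper: "v (x + k) (t + l)
        \<le> c'\<^sup>2 * \<sigma> / 2 + integral {t + l..t1} (\<lambda>s. h (line s) s) + v y t1"
      using value_le_line[OF _ _ _ c'_eq] t r l tt \<sigma>
      by (simp add: line_def t1_def \<sigma>_def algebra_simps)
    \<comment> \<open>Expanding (c * \<sigma> + w)^2 / \<sigma>, the first two terms are exactly
      linear in (k, l) apart from the constant c^2 * \<tau>; only w^2 / \<sigma>, of order r^2 /
      \<tau> = \<epsilon>, is an error.\<close>
    have "c'\<^sup>2 * \<sigma> = (c' * \<sigma>)\<^sup>2 / \<sigma>" using \<sigma> by (simp add: power2_eq_square)
    also have "\<dots> = c\<^sup>2 * \<sigma> + 2 * c * w + w\<^sup>2 / \<sigma>"
      unfolding c's using \<sigma> by (simp add: power2_eq_square field_simps)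
    also have "w\<^sup>2 / \<sigma> \<le> ((N + 1) * r)\<^sup>2 / (\<tau> / 2)"
    proof (rule frac_le)
      show "w\<^sup>2 \<le> ((N + 1) * r)\<^sup>2" using w by (metis abs_ge_zero power2_abs power_mono)
    qed (use \<sigma> \<tau> in auto)
    also have "\<dots> = 2 * (N + 1)\<^sup>2 * (r\<^sup>2 / \<tau>)" by (simp add: power_mult_distrib)
    also have "r\<^sup>2 / \<tau> = \<epsilon>"
    proof -
      have "\<epsilon> * \<tau> = r\<^sup>2" using r by (simp add: \<epsilon>_def \<tau>_def flip: powr_add)
      then show ?thesis using \<tau> by (simp add: field_simps)
    qed
    finally have "c'\<^sup>2 * \<sigma> \<le> c\<^sup>2 * \<sigma> + 2 * c * w + 2 * (N + 1)\<^sup>2 * \<epsilon>" by simp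
    also have "c\<^sup>2 * \<sigma> + 2 * c * w = c\<^sup>2 * \<tau> + c\<^sup>2 * l - 2 * (c * k)"
      by (simp add: \<sigma>_def w_def power2_eq_square algebra_simps)
    finally have kinetic: "c'\<^sup>2 * \<sigma> / 2 \<le> c\<^sup>2 * \<tau> / 2 + c\<^sup>2 / 2 * l - c * k + (N + 1)\<^sup>2 * \<epsilon>"
      by simp
    have "r powr \<beta> * \<tau> = \<epsilon>" using r by (simp add: \<epsilon>_def \<tau>_def add.commute flip: powr_add)
    then have "2 * e * \<tau> = 2 * H * Q * \<epsilon>" by (simp add: e_def mult_ac)
    then have "v (x + k) (t + l) - v x t
        \<le> - c * k + (c\<^sup>2 / 2 - h x t) * l + ((N + 1)\<^sup>2 * \<epsilon> + 2 * H * Q * \<epsilon> + \<epsilon>)"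
      using upper kinetic potential lower by (simp add: algebra_simps)
    then show "v (x + k) (t + l) - v x t
        \<le> - c * k + (c\<^sup>2 / 2 - h x t) * l + slope_error H * r powr (1 + \<beta> / 2)"
      by (simp add: slope_error_def Q_def \<epsilon>_def N_def algebra_simps)
  qed
qed

text \<open>The constant is fixed before r, x and t. Phrasing smallness of r through a filter lets
  the bound be intersected later with its time-reversed counterpart.\<close>

lemma value_increment_le_on_box:
  assumes ab: "0 < a" "a \<le> b" "b < T"
  obtains C where "\<forall>\<^sub>F r in at_right 0. \<forall>x t. \<bar>x\<bar> \<le> R \<longrightarrow> t \<in> {a..b} \<longrightarrow>
      (\<exists>p q. \<forall>k l. \<bar>k\<bar> \<le> r \<longrightarrow> \<bar>l\<bar> \<le> r \<longrightarrow>
        v (x + k) (t + l) - v x t \<le> p * k + q * l + C * r powr (1 + \<beta> / 2))"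
proof -
  \<comment> \<open>The box is enlarged in space by the reach of the competing paths and in time
    halfway to 0 and T, so that they stay where one Hoelder constant applies.\<close>
  define R' where "R' = R + 2 * speed_bound + 1"
  obtain H where H: "0 \<le> H"
    "\<And>x y s t. \<lbrakk>\<bar>x\<bar> \<le> R'; \<bar>y\<bar> \<le> R'; s \<in> {a / 2..(b + T) / 2}; t \<in> {a / 2..(b + T) / 2}\<rbrakk>
      \<Longrightarrow> \<bar>h x s - h y t\<bar> \<le> H * (\<bar>x - y\<bar> + \<bar>s - t\<bar>) powr \<beta>"
    using holder_on_box[of "a / 2" "(b + T) / 2" R'] ab by auto
  have lim: "((\<lambda>r. r powr d) \<longlongrightarrow> 0) (at_right 0)" if "d > 0" for d :: real
    by (rule tendsto_zero_powrI[OF tendsto_ident_at tendsto_const _ that])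
       (auto simp: eventually_at_filter)
  have "\<forall>\<^sub>F r in at_right 0. r powr (1 - \<beta> / 2) < (T - b) / 2"
    "\<forall>\<^sub>F r in at_right 0. r powr (\<beta> / 2) < 1 / 2"
    by (rule order_tendstoD(2)[OF lim]; use ab beta in simp)+
  moreover have "\<forall>\<^sub>F r in at_right (0::real). r < min 1 (a / 2)" "\<forall>\<^sub>F r in at_right (0::real). 0 < r"
    by (rule order_tendstoD(2)[OF tendsto_ident_at]; use ab in simp)
       (simp add: eventually_at_right_less)
  ultimately have "\<forall>\<^sub>F r in at_right 0. \<forall>x t. \<bar>x\<bar> \<le> R \<longrightarrow> t \<in> {a..b} \<longrightarrow>
      (\<exists>p q. \<forall>k l. \<bar>k\<bar> \<le> r \<longrightarrow> \<bar>l\<bar> \<le> r \<longrightarrow>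
        v (x + k) (t + l) - v x t \<le> p * k + q * l + slope_error H * r powr (1 + \<beta> / 2))"
  proof eventually_elim
    case (elim r)
    have "r powr (\<beta> / 2) * r powr (1 - \<beta> / 2) \<le> 1 / 2 * r powr (1 - \<beta> / 2)"
      using elim by (intro mult_right_mono) auto
    then have r2: "2 * r \<le> r powr (1 - \<beta> / 2)" using elim by (simp flip: powr_add)
    show ?case
    proof (intro allI impI)
      fix x t assume x: "\<bar>x\<bar> \<le> R" and t: "t \<in> {a..b}"
      obtain p q where "\<And>k l. \<lbrakk>\<bar>k\<bar> \<le> r; \<bar>l\<bar> \<le> r\<rbrakk> \<Longrightarrow>
          v (x + k) (t + l) - v x t \<le> p * k + q * l + slope_error H * r powr (1 + \<beta> / 2)"
      proof (rule value_increment_le[OF H])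
        show "a / 2 \<le> t - r" using elim t by auto
        show "t + r powr (1 - \<beta> / 2) \<le> (b + T) / 2" using elim t by (simp add: field_simps)
        show "\<bar>x\<bar> + 2 * speed_bound + 1 \<le> R'" using x by (simp add: R'_def)
      qed (use elim r2 ab t in auto)
      then show "\<exists>p q. \<forall>k l. \<bar>k\<bar> \<le> r \<longrightarrow> \<bar>l\<bar> \<le> r \<longrightarrow>
        v (x + k) (t + l) - v x t \<le> p * k + q * l + slope_error H * r powr (1 + \<beta> / 2)"
        by blast
    qed
  qed
  then show ?thesis by (rule that)
qed

end

section \<open>Time reversal and two-sided approximation\<close>

locale reversible_value_function = value_function +
  assumes reverse_repr: "value_repr (\<lambda>x s. h x (T - s)) T (\<lambda>x t. - v x (T - t))"
begin

text \<open>The reflection of time is an isometry of the strip, so bounds, Lipschitz and Hoelder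
  conditions carry over unchanged. The representation formula for the reversal is the one genuinely
  additional assumption.\<close>

sublocale reverse: value_function T \<beta> M B L "\<lambda>x s. h x (T - s)" "\<lambda>x t. - v x (T - t)"
proof
  let ?\<phi> = "\<lambda>p :: real \<times> real. (fst p, T - snd p)"
  have \<phi>: "continuous_on S ?\<phi>" for S by (intro continuous_intros)
  have dist_\<phi>: "dist (?\<phi> p) (?\<phi> q) = dist p q" for p q
    by (simp add: dist_prod_def dist_real_def abs_minus_commute)
  have "continuous_on (UNIV \<times> {0..T}) ((\<lambda>(x, t). h x t) \<circ> ?\<phi>)"
    by (rule continuous_on_compose[OF \<phi> continuous_on_subset[OF h_cont]]) auto
  then show "continuous_on (UNIV \<times> {0..T}) (\<lambda>(x, t). h x (T - t))"
    by (simp add: o_def case_prod_beta)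
  show "locally_holder_on \<beta> (UNIV \<times> {0<..<T}) (\<lambda>(x, t). h x (T - t))"
    unfolding locally_holder_on_def
  proof (intro allI impI)
    fix K :: "(real \<times> real) set" assume K: "compact K \<and> K \<subseteq> UNIV \<times> {0<..<T}"
    then have "compact (?\<phi> ` K)" "?\<phi> ` K \<subseteq> UNIV \<times> {0<..<T}"
      by (auto intro!: compact_continuous_image \<phi>)
    then obtain C where C: "\<forall>p\<in>?\<phi> ` K. \<forall>q\<in>?\<phi> ` K.
        \<bar>(\<lambda>(x, t). h x t) p - (\<lambda>(x, t). h x t) q\<bar> \<le> C * dist p q powr \<beta>"
      using h_holder unfolding locally_holder_on_def by meson
    have "\<bar>(\<lambda>(x, t). h x (T - t)) p - (\<lambda>(x, t). h x (T - t)) q\<bar> \<le> C * dist p q powr \<beta>"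
      if "p \<in> K" "q \<in> K" for p q
      using C[rule_format, OF imageI imageI, OF that]
      unfolding dist_\<phi> by (simp add: case_prod_beta)
    then show "\<exists>C. \<forall>p\<in>K. \<forall>q\<in>K.
        \<bar>(\<lambda>(x, t). h x (T - t)) p - (\<lambda>(x, t). h x (T - t)) q\<bar> \<le> C * dist p q powr \<beta>"
      by blast
  qed
  show "L-lipschitz_on (UNIV \<times> {0..T}) (\<lambda>(x, t). - v x (T - t))"
  proof (rule lipschitz_onI)
    fix p q :: "real \<times> real" assume pq: "p \<in> UNIV \<times> {0..T}" "q \<in> UNIV \<times> {0..T}"
    have "dist ((\<lambda>(x, t). v x t) (?\<phi> p)) ((\<lambda>(x, t). v x t) (?\<phi> q)) \<le> L * dist (?\<phi> p) (?\<phi> q)"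
      by (rule lipschitz_onD[OF v_lip]) (use pq in auto)
    then show "dist ((\<lambda>(x, t). - v x (T - t)) p) ((\<lambda>(x, t). - v x (T - t)) q) \<le> L * dist p q"
      unfolding dist_\<phi> by (simp add: case_prod_beta dist_minus)
  qed (rule lipschitz_on_nonneg[OF v_lip])
qed (use beta h_bdd v_bdd reverse_repr in auto)

text \<open>The slopes do not depend on the scale, which is what differentiability requires. The
  bound \<open>r0 \<le> T - b\<close> keeps t + r0 inside the time interval, where the Lipschitz
  estimate holds.\<close>

lemma affine_within_on_box:
  assumes ab: "0 < a" "a \<le> b" "b < T"
  obtains C r0 where "0 \<le> C" "0 < r0" "r0 \<le> T - b"
    "\<forall>x t. \<bar>x\<bar> \<le> R \<longrightarrow> t \<in> {a..b} \<longrightarrow>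
      (\<exists>P Q. \<forall>r. 0 < r \<longrightarrow> r \<le> r0 \<longrightarrow> affine_within v x t r (C * r powr (1 + \<beta> / 2)) P Q)"
proof -
  obtain C1 where up: "\<forall>\<^sub>F r in at_right 0. \<forall>x t. \<bar>x\<bar> \<le> R \<longrightarrow> t \<in> {a..b} \<longrightarrow>
      (\<exists>p q. \<forall>k l. \<bar>k\<bar> \<le> r \<longrightarrow> \<bar>l\<bar> \<le> r \<longrightarrow>
        v (x + k) (t + l) - v x t \<le> p * k + q * l + C1 * r powr (1 + \<beta> / 2))"
    by (rule value_increment_le_on_box[OF ab])
  obtain C2 where lo: "\<forall>\<^sub>F r in at_right 0. \<forall>x t. \<bar>x\<bar> \<le> R \<longrightarrow> t \<in> {T - b..T - a} \<longrightarrow>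
      (\<exists>p q. \<forall>k l. \<bar>k\<bar> \<le> r \<longrightarrow> \<bar>l\<bar> \<le> r \<longrightarrow>
        - v (x + k) (T - (t + l)) - - v x (T - t) \<le> p * k + q * l + C2 * r powr (1 + \<beta> / 2))"
    by (rule reverse.value_increment_le_on_box[of "T - b" "T - a"]) (use ab in auto)
  define C where "C = max 0 (C1 + 2 * C2)"
  have "\<forall>\<^sub>F r in at_right 0. \<forall>x t. \<bar>x\<bar> \<le> R \<longrightarrow> t \<in> {a..b} \<longrightarrow>
      (\<exists>p q. affine_within v x t r (C * r powr (1 + \<beta> / 2)) p q)"
    using up lo
  proof eventually_elim
    case (elim r)
    show ?case
    proof (intro allI impI)
      fix x t assume x: "\<bar>x\<bar> \<le> R" and t: "t \<in> {a..b}"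
      define e where "e = r powr (1 + \<beta> / 2)"
      obtain p q where pq: "\<And>k l. \<lbrakk>\<bar>k\<bar> \<le> r; \<bar>l\<bar> \<le> r\<rbrakk> \<Longrightarrow>
          v (x + k) (t + l) - v x t \<le> p * k + q * l + C1 * e"
        using elim(1) x t unfolding e_def by blast
      have "T - t \<in> {T - b..T - a}" using t by auto
      then obtain p' q' where pq': "\<And>k l. \<lbrakk>\<bar>k\<bar> \<le> r; \<bar>l\<bar> \<le> r\<rbrakk> \<Longrightarrow>
          - v (x + k) (T - (T - t + l)) - - v x (T - (T - t)) \<le> p' * k + q' * l + C2 * e"
        using elim(2) x unfolding e_def by blast
      have "affine_within v x t r (C1 * e + 2 * (C2 * e)) p q"
      proof (rule affine_within_two_sided[OF pq])
        fix k l assume "\<bar>k\<bar> \<le> r" "\<bar>l\<bar> \<le> r"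
        \<comment> \<open>Negating the function flips both slopes, and reversing time flips the time
          slope back, so only p' changes sign.\<close>
        then show "(- p') * k + q' * l - C2 * e \<le> v (x + k) (t + l) - v x t"
          using pq'[of k "- l"] by simp
      qed
      moreover have "C1 * e + 2 * (C2 * e) \<le> C * e"
      proof -
        have "(C1 + 2 * C2) * e \<le> C * e" by (rule mult_right_mono) (auto simp: C_def e_def)
        then show ?thesis by (simp add: algebra_simps)
      qed
      ultimately show "\<exists>p q. affine_within v x t r (C * r powr (1 + \<beta> / 2)) p q"
        unfolding affine_within_def e_def by (meson order_trans)
    qed
  qed
  then obtain d where d: "0 < d" "\<And>r. \<lbrakk>0 < r; r < d\<rbrakk> \<Longrightarrow> \<forall>x t. \<bar>x\<bar> \<le> R \<longrightarrow> t \<in> {a..b} \<longrightarrow>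
      (\<exists>p q. affine_within v x t r (C * r powr (1 + \<beta> / 2)) p q)"
    unfolding eventually_at_right_field by blast
  define r0 where "r0 = min (d / 2) (T - b)"
  have r0: "0 < r0" "r0 < d" "r0 \<le> T - b" using d(1) ab by (auto simp: r0_def)
  define C' where "C' = C * (1 + 8 / (1 - 2 powr - (\<beta> / 2))) * 2 powr (1 + \<beta> / 2)"
  have C: "0 \<le> C" by (simp add: C_def)
  have "2 powr - (\<beta> / 2) < 1" using beta powr_less_mono[of "- (\<beta> / 2)" 0 2] by simp
  then have C': "0 \<le> C'" using C by (simp add: C'_def)
  show ?thesis
  proof (rule that[OF C' r0(1,3)], intro allI impI)
    fix x t assume xt: "\<bar>x\<bar> \<le> R" "t \<in> {a..b}"
    have "\<exists>p q. affine_within v x t r (C * r powr (1 + \<beta> / 2)) p q" if "0 < r" "r \<le> r0" for r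
      using d(2)[of r] that r0 xt by auto
    then obtain P Q where "\<And>r. \<lbrakk>0 < r; r \<le> r0\<rbrakk> \<Longrightarrow>
        affine_within v x t r (C' * r powr (1 + \<beta> / 2)) P Q"
      unfolding C'_def using affine_within_all_scales[OF _ r0(1) C] beta
      by (metis half_gt_zero)
    then show "\<exists>P Q. \<forall>r. 0 < r \<longrightarrow> r \<le> r0 \<longrightarrow> affine_within v x t r (C' * r powr (1 + \<beta> / 2)) P Q"
      by blast
  qed
qed

theorem C1_holder: "C1_holder_loc (\<beta> / 2) (UNIV \<times> {0<..<T}) (\<lambda>(x, t). v x t)"
proof -
  let ?v = "\<lambda>(x, t). v x t"
  have \<beta>2: "0 < \<beta> / 2" "\<beta> / 2 \<le> 1" using beta by auto
  have "\<exists>P Q. (?v has_derivative (\<lambda>(a, b). P * a + Q * b)) (at z)" if z: "z \<in> UNIV \<times> {0<..<T}" for z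
  proof -
    obtain x t where z': "z = (x, t)" "0 < t" "t < T" using z by auto
    obtain C r0 where "0 < r0" and approx: "\<forall>x' t'. \<bar>x'\<bar> \<le> \<bar>x\<bar> \<longrightarrow> t' \<in> {t..t} \<longrightarrow>
      (\<exists>P Q. \<forall>r. 0 < r \<longrightarrow> r \<le> r0 \<longrightarrow> affine_within v x' t' r (C * r powr (1 + \<beta> / 2)) P Q)"
      by (rule affine_within_on_box[OF z'(2) order_refl z'(3)])
    have "t \<in> {t..t}" by simp
    with approx obtain P Q where
      "\<And>r. \<lbrakk>0 < r; r \<le> r0\<rbrakk> \<Longrightarrow> affine_within v x t r (C * r powr (1 + \<beta> / 2)) P Q"
      by blast
    then have "(?v has_derivative (\<lambda>(a, b). P * a + Q * b)) (at z)"
      unfolding z'(1) by (rule affine_within_has_derivative[OF \<beta>2(1) \<open>0 < r0\<close>])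
    then show ?thesis by blast
  qed
  then obtain fx ft where der: "\<And>z. z \<in> UNIV \<times> {0<..<T} \<Longrightarrow>
      (?v has_derivative (\<lambda>(a, b). fx z * a + ft z * b)) (at z)"
    by metis
  have holder: "(\<exists>C. \<forall>p\<in>K. \<forall>q\<in>K. \<bar>fx p - fx q\<bar> \<le> C * dist p q powr (\<beta> / 2))
      \<and> (\<exists>C. \<forall>p\<in>K. \<forall>q\<in>K. \<bar>ft p - ft q\<bar> \<le> C * dist p q powr (\<beta> / 2))"
    if K: "compact K" "K \<subseteq> UNIV \<times> {0<..<T}" for K
  proof (cases "K = {}")
    case False
    obtain R a b where ab: "0 < a" "a \<le> b" "b < T"
      and R: "\<And>x t. (x, t) \<in> K \<Longrightarrow> \<bar>x\<bar> \<le> R \<and> t \<in> {a..b}"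
      by (rule compact_subset_box[OF K False]) auto
    obtain C r0 where C: "0 \<le> C" and r0: "0 < r0" "r0 \<le> T - b"
      and approx: "\<forall>x t. \<bar>x\<bar> \<le> R \<longrightarrow> t \<in> {a..b} \<longrightarrow>
      (\<exists>P Q. \<forall>r. 0 < r \<longrightarrow> r \<le> r0 \<longrightarrow> affine_within v x t r (C * r powr (1 + \<beta> / 2)) P Q)"
      by (rule affine_within_on_box[OF ab])
    \<comment> \<open>The slopes supplied for the box around K and the derivatives chosen pointwise
      earlier come from different constants; uniqueness of the derivative identifies them.\<close>
    have aff: "affine_within v x t r (C * r powr (1 + \<beta> / 2)) (fx (x, t)) (ft (x, t))"
      if z: "(x, t) \<in> K" and r: "0 < r" "r \<le> r0" for x t r
    proof -
      have "\<bar>x\<bar> \<le> R" "t \<in> {a..b}" using R[OF z] by simp_all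
      with approx obtain P Q where PQ: "\<And>r. \<lbrakk>0 < r; r \<le> r0\<rbrakk> \<Longrightarrow> affine_within v x t r (C * r powr (1 + \<beta> / 2)) P Q"
        by blast
      have PQ': "(?v has_derivative (\<lambda>(a, b). P * a + Q * b)) (at (x, t))"
        by (rule affine_within_has_derivative[OF \<beta>2(1) r0(1) PQ])
      have "(x, t) \<in> UNIV \<times> {0<..<T}" using z K(2) by blast
      from has_derivative_unique[OF PQ' der[OF this]]
      have "(\<lambda>(a, b). P * a + Q * b) = (\<lambda>(a, b). fx (x, t) * a + ft (x, t) * b)" .
      from fun_cong[OF this, of "(1, 0)"] fun_cong[OF this, of "(0, 1)"]
      have "P = fx (x, t)" "Q = ft (x, t)" by simp_all
      then show ?thesis using PQ[OF r] by simp
    qed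
    \<comment> \<open>At scale r0 the affine approximation and the Lipschitz bound give slope times
      r0 at most L * r0 plus the approximation error; dividing by r0 yields D.\<close>
    define D where "D = L + C * r0 powr (\<beta> / 2)"
    have Dr0: "D * r0 = L * r0 + C * r0 powr (1 + \<beta> / 2)"
      using r0 by (simp add: D_def powr_add algebra_simps)
    have bound: "\<bar>fx z\<bar> \<le> D \<and> \<bar>ft z\<bar> \<le> D" if z: "z \<in> K" for z
    proof -
      obtain x t where xt: "z = (x, t)" by force
      have t: "0 \<le> t" "t \<le> T" "t + r0 \<le> T" using R[of x t] z xt ab r0 by auto
      note A = affine_withinD[OF aff[OF z[unfolded xt] r0(1) order_refl]]
      have "\<bar>fx z * r0\<bar> \<le> D * r0"
        using A[of r0 0] v_lipschitz[of t t "x + r0" x] t r0 unfolding Dr0 by (simp add: xt)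
      moreover have "\<bar>ft z * r0\<bar> \<le> D * r0"
        using A[of 0 r0] v_lipschitz[of "t + r0" t x x] t r0 unfolding Dr0 by (simp add: xt)
      ultimately show ?thesis using r0 by (simp add: abs_mult)
    qed
    \<comment> \<open>The slope comparison uses \<rho> = \<open>dist p q\<close>: distinctness makes
      it positive, and half of r0 leaves room for the box of size 2 * \<rho>.\<close>
    have local: "\<bar>fx p - fx q\<bar> \<le> 9 * C * dist p q powr (\<beta> / 2) \<and>
        \<bar>ft p - ft q\<bar> \<le> 9 * C * dist p q powr (\<beta> / 2)"
      if "p \<in> K" "q \<in> K" "p \<noteq> q" "dist p q \<le> r0 / 2" for p q
    proof -
      obtain x t x' t' where eqs: "p = (x', t')" "q = (x, t)" by force
      have "\<bar>x' - x\<bar> \<le> dist p q" "\<bar>t' - t\<bar> \<le> dist p q"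
        using dist_fst_le[of p q] dist_snd_le[of p q] by (simp_all add: eqs dist_real_def)
      then show ?thesis
        unfolding eqs using that r0
        by (intro conjI affine_within_slope_holder[OF \<beta>2 C aff aff]) (auto simp: eqs)
    qed
    have "0 < r0 / 2" "0 \<le> 9 * C" using r0 C by auto
    then show ?thesis
      by (intro conjI holder_from_local_holder[OF _ \<beta>2(1), of "r0 / 2" "9 * C" K _ D])
         (use local bound in auto)
  qed auto
  show ?thesis
    unfolding C1_holder_loc_def
  proof (rule exI[of _ fx], rule exI[of _ ft], intro conjI ballI)
    show "locally_holder_on (\<beta> / 2) (UNIV \<times> {0<..<T}) fx"
      "locally_holder_on (\<beta> / 2) (UNIV \<times> {0<..<T}) ft"
      unfolding locally_holder_on_def using holder by simp_all
  qed (rule der)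
qed

end

theorem theorem4p22:
  fixes T \<beta> :: real and h u :: "real \<Rightarrow> real \<Rightarrow> real"
  assumes T_pos: "T > 0"
    and beta: "0 < \<beta>" "\<beta> < 1"
    and h_cont: "continuous_on (UNIV \<times> {0..T}) (\<lambda>(x, t). h x t)"
    and h_bdd: "\<exists>M. \<forall>x. \<forall>t\<in>{0..T}. \<bar>h x t\<bar> \<le> M"
    and h_holder: "locally_holder_on \<beta> (UNIV \<times> {0<..<T}) (\<lambda>(x, t). h x t)"
    and u_bdd: "\<exists>M. \<forall>x. \<forall>t\<in>{0..T}. \<bar>u x t\<bar> \<le> M"
    and u_lip: "\<exists>L. L-lipschitz_on (UNIV \<times> {0..T}) (\<lambda>(x, t). u x t)"
    and u_x_bdd: "\<exists>M. \<forall>x. \<forall>t\<in>{0..T}. \<forall>D.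
                    ((\<lambda>y. u y t) has_real_derivative D) (at x) \<longrightarrow> \<bar>D\<bar> \<le> M"
    and u_repr: "value_repr h T u"
    and w_repr: "value_repr (\<lambda>x s. h x (T - s)) T (\<lambda>x t. - u x (T - t))"
  shows "C1_holder_loc (\<beta> / 2) (UNIV \<times> {0<..<T}) (\<lambda>(x, t). u x t)"
proof -
  obtain M B L where "\<And>x t. t \<in> {0..T} \<Longrightarrow> \<bar>h x t\<bar> \<le> M" "\<And>x t. t \<in> {0..T} \<Longrightarrow> \<bar>u x t\<bar> \<le> B"
    "L-lipschitz_on (UNIV \<times> {0..T}) (\<lambda>(x, t). u x t)"
    using h_bdd u_bdd u_lip by blast
  then interpret reversible_value_function T \<beta> M B L h u
    using beta h_cont h_holder u_repr w_repr by unfold_locales auto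
  show ?thesis by (rule C1_holder)
qed

end
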